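(* A unital commutative pro-$C^*$-algebra is barreled if and only if it is (isomorphic to one) of the form $C(X)$ with the compact-open topology, for some functionally $T_2$ space $X$ such that all relatively pseudocompact subsets $A\subseteq X$ are relatively compact.
   Context: A pro-$C^*$-algebra is a cofiltered limit of $C^*$-algebras in the category of topological $*$-algebras; equivalently, a complete Hausdorff topological $*$-algebra over $\mathbb{C}$ whose topology is generated by its continuous $C^*$-seminorms. Isomorphism means isomorphism of topological $*$-algebras. A space $X$ is functionally $T_2$ (functionally Hausdorff) if any two distinct points are distinguished by some continuous real-valued function on $X$. $C(X)$ denotes the algebra of continuous complex-valued functions on $X$; the compact-open topology is that of uniform convergence on all compact subsets of $X$. A subset $A\subseteq X$ is relatively compact if its closure in $X$ is compact, and relatively pseudocompact if every continuous real-valued function on $X$ is bounded on $A$. A locally convex topological vector space is barreled if every barrel (absolutely convex, absorbing, closed subset) is a neighborhood of the origin. *)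

theory Defs
  imports "HOL-Analysis.Analysis"
begin

section \<open>Topological *-algebras and pro-C*-algebras\<close>

text \<open>
  The underlying set, ring structure and topology of an algebra come from the type classes on its
  type; the complex scalar multiplication and the involution are parameters. A unit is requested
  by adding the class \<open>monoid_mult\<close> (or \<open>comm_monoid_mult\<close>) rather than by using \<open>ring_1\<close>,
  because the latter would exclude the zero algebra (which is \<open>C(X)\<close> for empty \<open>X\<close>).

  The class \<open>uniform_topological_group_add\<close> forces the uniformity to be the one induced by the
  additive topological group (lemma \<open>uniformity_eq_translations_nhds_0\<close> below), so \<open>complete\<close>
  has its usual meaning for topological vector spaces.
\<close>

lemma uniformity_eq_translations_nhds_0:
  "(uniformity :: ('a :: uniform_topological_group_add \<times> 'a) filter)
     = filtercomap (\<lambda>(x, y). y - x) (nhds 0)"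
  by (rule cauchy_seq_finset_iff_vanishing)

locale topological_star_algebra = vector_space scaleC
  for scaleC :: "complex \<Rightarrow> 'a \<Rightarrow>
      'a :: {ring, topological_semigroup_mult, uniform_topological_group_add}" +
  fixes star :: "'a \<Rightarrow> 'a"
  assumes scale_mult_left: "scaleC c (x * y) = scaleC c x * y"
    and scale_mult_right: "scaleC c (x * y) = x * scaleC c y"
    and continuous_scale: "continuous_on UNIV (\<lambda>(c, x). scaleC c x)"
    and star_star: "star (star x) = x"
    and star_add: "star (x + y) = star x + star y"
    and star_scale: "star (scaleC c x) = scaleC (cnj c) (star x)"
    and star_mult: "star (x * y) = star y * star x"
    and continuous_star: "continuous_on UNIV star"

definition cstar_seminorm ::
  "(complex \<Rightarrow> 'a \<Rightarrow> 'a) \<Rightarrow> ('a \<Rightarrow> 'a) \<Rightarrow> ('a :: ring \<Rightarrow> real) \<Rightarrow> bool" where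
  "cstar_seminorm scaleC star p \<longleftrightarrow>
     (\<forall>x. 0 \<le> p x) \<and>
     (\<forall>x y. p (x + y) \<le> p x + p y) \<and>
     (\<forall>c x. p (scaleC c x) = cmod c * p x) \<and>
     (\<forall>x y. p (x * y) \<le> p x * p y) \<and>
     (\<forall>x. p (star x * x) = (p x)\<^sup>2)"

locale pro_cstar_algebra = topological_star_algebra scaleC star
  for scaleC :: "complex \<Rightarrow> 'a \<Rightarrow>
      'a :: {ring, t2_space, topological_semigroup_mult, uniform_topological_group_add}"
    and star :: "'a \<Rightarrow> 'a" +
  assumes complete_UNIV: "complete (UNIV :: 'a set)"
    and topology_generated_by_cstar_seminorms:
      "(open :: 'a set \<Rightarrow> bool) =
         generate_topology
           {{y. p (y - x) < e} | p x e. cstar_seminorm scaleC star p \<and> continuous_on UNIV p}"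


section \<open>Barreled spaces\<close>

text \<open>Absolute convexity and absorption are with respect to the complex scalars.\<close>

definition absolutely_convex :: "(complex \<Rightarrow> 'a \<Rightarrow> 'a) \<Rightarrow> 'a :: ab_group_add set \<Rightarrow> bool" where
  "absolutely_convex scaleC B \<longleftrightarrow>
     (\<forall>x\<in>B. \<forall>y\<in>B. \<forall>a b. cmod a + cmod b \<le> 1 \<longrightarrow> scaleC a x + scaleC b y \<in> B)"

definition absorbing :: "(complex \<Rightarrow> 'a \<Rightarrow> 'a) \<Rightarrow> 'a set \<Rightarrow> bool" where
  "absorbing scaleC B \<longleftrightarrow> (\<forall>x. \<exists>r>0. \<forall>c. cmod c \<ge> r \<longrightarrow> x \<in> scaleC c ` B)"

definition barrel ::
  "(complex \<Rightarrow> 'a \<Rightarrow> 'a) \<Rightarrow> 'a :: {ab_group_add, topological_space} set \<Rightarrow> bool" where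
  "barrel scaleC B \<longleftrightarrow> absolutely_convex scaleC B \<and> absorbing scaleC B \<and> closed B"

definition barreled ::
  "(complex \<Rightarrow> 'a \<Rightarrow> 'a :: {ab_group_add, topological_space}) \<Rightarrow> bool" where
  "barreled scaleC \<longleftrightarrow> (\<forall>B. barrel scaleC B \<longrightarrow> 0 \<in> interior B)"


section \<open>Topological spaces\<close>

definition functionally_Hausdorff :: "'x topology \<Rightarrow> bool" where
  "functionally_Hausdorff X \<longleftrightarrow>
     (\<forall>x\<in>topspace X. \<forall>y\<in>topspace X.
        x \<noteq> y \<longrightarrow> (\<exists>f. continuous_map X euclideanreal f \<and> f x \<noteq> f y))"

definition relatively_compact_in :: "'x topology \<Rightarrow> 'x set \<Rightarrow> bool" where
  "relatively_compact_in X A \<longleftrightarrow> A \<subseteq> topspace X \<and> compactin X (X closure_of A)"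

definition relatively_pseudocompact_in :: "'x topology \<Rightarrow> 'x set \<Rightarrow> bool" where
  "relatively_pseudocompact_in X A \<longleftrightarrow>
     A \<subseteq> topspace X \<and> (\<forall>f. continuous_map X euclideanreal f \<longrightarrow> bounded (f ` A))"


section \<open>The algebra C(X) with the compact-open topology\<close>

text \<open>
  A function on \<open>topspace X\<close> is represented by its extension with value \<open>undefined\<close> outside
  \<open>topspace X\<close>, so that equality in \<open>C(X)\<close> is equality on \<open>topspace X\<close>.
\<close>

definition cfun :: "'x topology \<Rightarrow> ('x \<Rightarrow> complex) set" where
  "cfun X = {f \<in> extensional (topspace X). continuous_map X euclidean f}"

definition compact_open :: "'x topology \<Rightarrow> ('x \<Rightarrow> complex) topology" where
  "compact_open X = topology_generated_by
     {{g \<in> cfun X. \<forall>x\<in>K. dist (f x) (g x) < e} | f K e. f \<in> cfun X \<and> compactin X K \<and> 0 < e}"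

lemma topspace_compact_open [simp]: "topspace (compact_open X) = cfun X"
proof -
  have "f \<in> \<Union> {{g \<in> cfun X. \<forall>x\<in>K. dist (f x) (g x) < e} | f K e.
          f \<in> cfun X \<and> compactin X K \<and> 0 < e}" if "f \<in> cfun X" for f
    using that by (intro UnionI[where X = "cfun X"]) (auto intro!: exI[of _ f] exI[of _ "{}"] exI[of _ "1::real"])
  then show ?thesis
    unfolding compact_open_def topology_generated_by_topspace by blast
qed

text \<open>
  An isomorphism of topological *-algebras onto \<open>C(X)\<close> with pointwise operations. Preservation
  of units is automatic, by surjectivity.
\<close>

definition star_algebra_iso_cfun ::
  "(complex \<Rightarrow> 'a \<Rightarrow> 'a) \<Rightarrow> ('a \<Rightarrow> 'a) \<Rightarrow> 'x topology
     \<Rightarrow> ('a :: {ring, topological_space} \<Rightarrow> 'x \<Rightarrow> complex) \<Rightarrow> bool" where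
  "star_algebra_iso_cfun scaleC star X \<phi> \<longleftrightarrow>
     homeomorphic_map euclidean (compact_open X) \<phi> \<and>
     (\<forall>a b. \<phi> (a + b) = (\<lambda>x\<in>topspace X. \<phi> a x + \<phi> b x)) \<and>
     (\<forall>c a. \<phi> (scaleC c a) = (\<lambda>x\<in>topspace X. c * \<phi> a x)) \<and>
     (\<forall>a b. \<phi> (a * b) = (\<lambda>x\<in>topspace X. \<phi> a x * \<phi> b x)) \<and>
     (\<forall>a. \<phi> (star a) = (\<lambda>x\<in>topspace X. cnj (\<phi> a x)))"

definition isomorphic_to_cfun ::
  "(complex \<Rightarrow> 'a \<Rightarrow> 'a :: {ring, topological_space}) \<Rightarrow> ('a \<Rightarrow> 'a) \<Rightarrow> 'x topology \<Rightarrow> bool" where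
  "isomorphic_to_cfun scaleC star X \<longleftrightarrow> (\<exists>\<phi>. star_algebra_iso_cfun scaleC star X \<phi>)"

text \<open>
  HOL cannot quantify existentially over the type of points of \<open>X\<close>. The intended statement is an
  equivalence with the existence of a space \<open>X\<close> on any type at all; it is rendered by letting the
  direct implication produce \<open>X\<close> on the type of functions from the algebra to the complex numbers
  (a home for its characters), and the converse accept an \<open>X\<close> on an arbitrary type.
\<close>

end

theory Submission
  imports Defs
begin

text \<open>
  The algebra is represented on its continuous characters. For a continuous \<open>C\<^sup>*\<close>-seminorm \<open>p\<close> the
  set \<open>K\<^sub>p\<close> of characters bounded by \<open>p\<close> is compact and \<open>p\<close> is the supremum over it; the latter needs no
  maximal ideals, since a minimal square-multiplicative seminorm below \<open>p\<close> is multiplicative and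
  hence, by Gelfand--Mazur, the modulus of a character. With the colimit topology of the \<open>K\<^sub>p\<close>,
  Stone--Weierstrass and completeness turn the algebra into the algebra of all continuous functions.
  If it is barreled and \<open>A\<close> is a relatively pseudocompact set of characters, then
  \<open>{a. \<forall>\<omega>\<in>A. \<bar>\<omega> a\<bar> \<le> 1}\<close> is a barrel, so \<open>A \<subseteq> K\<^sub>p\<close> for some \<open>p\<close>. Hence \<open>A\<close> is relatively compact,
  and the topology is the compact-open one.

  Conversely (Nachbin--Shirota), a barrel in \<open>C(X)\<close> contains a uniform ball and has a relatively
  pseudocompact support, both by a Baire category argument. If the support is relatively compact, a
  function that is small on it is the sum of a uniformly small function and one that vanishes near
  the support, and the latter lies in all multiples of the barrel by a partition of unity.
\<close>

section \<open>Characters bounded by a seminorm\<close>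

locale commutative_algebra = vector_space scaleC
  for scaleC :: "complex \<Rightarrow> 'a \<Rightarrow> 'a :: {comm_ring, comm_monoid_mult}" +
  assumes scale_mult: "scaleC c (x * y) = scaleC c x * y"
begin

lemma scale_mult': "scaleC c (x * y) = x * scaleC c y"
  by (metis mult.commute scale_mult)

text \<open>Homogeneity and the square condition are stated as inequalities, the form in which
  limits and infima inherit them; equality follows in \<open>useminorm_scale\<close> and
  \<open>useminorm_square\<close>. The model is a supremum of moduli of characters.\<close>

definition uniform_seminorm :: "('a \<Rightarrow> real) \<Rightarrow> bool" where
  "uniform_seminorm q \<longleftrightarrow>
     (\<forall>x. 0 \<le> q x) \<and>
     (\<forall>x y. q (x + y) \<le> q x + q y) \<and>
     (\<forall>c x. q (scaleC c x) \<le> cmod c * q x) \<and>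
     (\<forall>x y. q (x * y) \<le> q x * q y) \<and>
     (\<forall>x. (q x)\<^sup>2 \<le> q (x * x))"

context
  fixes q assumes q: "uniform_seminorm q"
begin

lemma useminorm_nonneg: "0 \<le> q x"
  using q by (simp add: uniform_seminorm_def)

lemma useminorm_add: "q (x + y) \<le> q x + q y"
  using q by (simp add: uniform_seminorm_def)

lemma useminorm_mult: "q (x * y) \<le> q x * q y"
  using q by (simp add: uniform_seminorm_def)

lemma useminorm_square: "q (x * x) = (q x)\<^sup>2"
  using q useminorm_mult[of x x] by (auto simp: uniform_seminorm_def power2_eq_square intro: antisym)

lemma useminorm_scale: "q (scaleC c x) = cmod c * q x"
proof (cases "c = 0")
  case True
  have "q (scaleC c x) \<le> cmod c * q x"
    using q by (simp add: uniform_seminorm_def)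
  then show ?thesis
    using True useminorm_nonneg[of "scaleC c x"] by auto
next
  case False
  have "q x = q (scaleC (inverse c) (scaleC c x))"
    using False by simp
  also have "\<dots> \<le> cmod (inverse c) * q (scaleC c x)"
    using q unfolding uniform_seminorm_def by blast
  finally have "cmod c * q x \<le> q (scaleC c x)"
    using False by (simp add: norm_divide inverse_eq_divide pos_le_divide_eq mult.commute)
  moreover have "q (scaleC c x) \<le> cmod c * q x"
    using q by (simp add: uniform_seminorm_def)
  ultimately show ?thesis by simp
qed

lemma useminorm_zero: "q 0 = 0"
  using useminorm_scale[of 0 0] by simp

lemma useminorm_minus: "q (- x) = q x"
  using useminorm_scale[of "-1" x] by simp

lemma useminorm_diff: "q (x - y) \<le> q x + q y"
  using useminorm_add[of x "- y"] by (simp add: useminorm_minus)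

lemma useminorm_one: "q a \<noteq> 0 \<Longrightarrow> q 1 = 1"
  using useminorm_square[of 1] useminorm_mult[of 1 a] useminorm_nonneg[of a]
  by (auto simp: power2_eq_square)

lemma useminorm_power_le: "q 1 = 1 \<Longrightarrow> q (a ^ n) \<le> q a ^ n"
proof (induction n)
  case (Suc n)
  have "q (a ^ Suc n) \<le> q a * q (a ^ n)"
    using useminorm_mult by simp
  also have "\<dots> \<le> q a ^ Suc n"
    using Suc useminorm_nonneg by (simp add: mult_left_mono)
  finally show ?case .
qed simp

lemma useminorm_power_two: "q (a ^ (2 ^ k)) = q a ^ (2 ^ k)"
proof (induction k)
  case (Suc k)
  have "q (a ^ (2 ^ Suc k)) = q (a ^ 2 ^ k * a ^ 2 ^ k)"
    by (simp add: power_add[symmetric] mult_2)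
  also have "\<dots> = q a ^ (2 ^ Suc k)"
    by (simp add: useminorm_square Suc power_mult[symmetric] mult.commute)
  finally show ?case .
qed simp

text \<open>Repeated squaring gives equality at exponent \<open>2 ^ n\<close>. Completing
  \<open>n\<close> to \<open>2 ^ n\<close> costs at most the factor
  \<open>q a ^ (2 ^ n - n)\<close>, which is positive and cancels.\<close>

lemma useminorm_power:
  assumes "q a \<noteq> 0"
  shows "q (a ^ n) = q a ^ n"
proof (rule antisym)
  have q1: "q 1 = 1"
    using assms by (rule useminorm_one)
  show "q (a ^ n) \<le> q a ^ n"
    by (rule useminorm_power_le[OF q1])
  have n: "2 ^ n = n + (2 ^ n - n)"
    by (simp add: less_exp less_imp_le_nat)
  have "q a ^ n * q a ^ (2 ^ n - n) = q (a ^ n * a ^ (2 ^ n - n))"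
    by (metis n power_add useminorm_power_two)
  also have "\<dots> \<le> q (a ^ n) * q (a ^ (2 ^ n - n))"
    by (rule useminorm_mult)
  also have "\<dots> \<le> q (a ^ n) * q a ^ (2 ^ n - n)"
    by (intro mult_left_mono useminorm_power_le q1 useminorm_nonneg)
  finally show "q a ^ n \<le> q (a ^ n)"
    using assms useminorm_nonneg[of a] by (simp add: zero_less_power order_le_less)
qed

end

section \<open>Localization of a seminorm at an element\<close>

text \<open>For \<open>q b \<noteq> 0\<close>, this is the largest uniform seminorm \<open>r \<le> q\<close> such that
  \<open>r (x * b) = r x * q b\<close> for all \<open>x\<close>.\<close>

definition localized :: "('a \<Rightarrow> real) \<Rightarrow> 'a \<Rightarrow> 'a \<Rightarrow> real" where
  "localized q b x = lim (\<lambda>n. q (x * b ^ n) / q b ^ n)"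

context
  fixes q b assumes q: "uniform_seminorm q" and b: "q b \<noteq> 0"
begin

lemma decseq_localized: "decseq (\<lambda>n. q (x * b ^ n) / q b ^ n)"
proof (rule decseq_SucI)
  fix n
  have pos: "0 < q b"
    using useminorm_nonneg[OF q, of b] b by simp
  have "q (x * b ^ Suc n) \<le> q (x * b ^ n) * q b"
    using useminorm_mult[OF q, of "x * b ^ n" b] by (simp add: ac_simps)
  then show "q (x * b ^ Suc n) / q b ^ Suc n \<le> q (x * b ^ n) / q b ^ n"
    using pos by (simp add: field_simps)
qed

lemma localized_tendsto: "(\<lambda>n. q (x * b ^ n) / q b ^ n) \<longlonglongrightarrow> localized q b x"
proof -
  obtain L where "(\<lambda>n. q (x * b ^ n) / q b ^ n) \<longlonglongrightarrow> L"
    using decseq_convergent[OF decseq_localized, of 0] useminorm_nonneg[OF q]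
    by (metis (no_types, lifting) divide_nonneg_nonneg zero_le_power)
  then show ?thesis
    unfolding localized_def using limI by metis
qed

lemma localized_le: "localized q b x \<le> q (x * b ^ n) / q b ^ n"
  using decseq_ge[OF decseq_localized localized_tendsto] .

lemma uniform_seminorm_localized: "uniform_seminorm (localized q b)"
  unfolding uniform_seminorm_def
proof (intro conjI allI)
  note L = localized_tendsto and nn = useminorm_nonneg[OF q]
  have pos: "0 < q b"
    using nn[of b] b by simp
  fix x y
  show "0 \<le> localized q b x"
    using nn by (intro LIMSEQ_le_const[OF L] exI[of _ 0]) auto
  show "localized q b (x + y) \<le> localized q b x + localized q b y"
  proof (rule LIMSEQ_le[OF L tendsto_add[OF L L]], intro exI allI impI)
    fix n
    show "q ((x + y) * b ^ n) / q b ^ n \<le> q (x * b ^ n) / q b ^ n + q (y * b ^ n) / q b ^ n"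
      using useminorm_add[OF q, of "x * b ^ n" "y * b ^ n"] pos
      by (simp add: add_divide_distrib[symmetric] distrib_right divide_right_mono)
  qed
  show "localized q b (scaleC c x) \<le> cmod c * localized q b x" for c
  proof (rule LIMSEQ_le[OF L tendsto_mult_left[OF L]], intro exI allI impI)
    fix n
    show "q (scaleC c x * b ^ n) / q b ^ n \<le> cmod c * (q (x * b ^ n) / q b ^ n)"
      using useminorm_scale[OF q, of c "x * b ^ n"] by (simp add: scale_mult)
  qed
  \<comment> \<open>Products are compared along even exponents, where \<open>b ^ (2 * n)\<close>
    supplies one factor \<open>b ^ n\<close> to each of \<open>x\<close> and
    \<open>y\<close>.\<close>
  have L2: "(\<lambda>n. q (x * b ^ (2 * n)) / q b ^ (2 * n)) \<longlonglongrightarrow> localized q b x" for x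
    using LIMSEQ_subseq_LIMSEQ[OF L, of "\<lambda>n. 2 * n"] by (simp add: o_def strict_mono_def)
  have split: "(x * y) * b ^ (2 * n) = (x * b ^ n) * (y * b ^ n)" for x y n
    unfolding mult_2 power_add by (simp add: ac_simps)
  show "localized q b (x * y) \<le> localized q b x * localized q b y"
  proof (rule LIMSEQ_le[OF L2 tendsto_mult[OF L L]], intro exI allI impI)
    fix n
    have "q ((x * y) * b ^ (2 * n)) \<le> q (x * b ^ n) * q (y * b ^ n)"
      unfolding split by (rule useminorm_mult[OF q])
    then show "q ((x * y) * b ^ (2 * n)) / q b ^ (2 * n)
        \<le> q (x * b ^ n) / q b ^ n * (q (y * b ^ n) / q b ^ n)"
      using pos by (simp add: divide_right_mono mult_2 power_add)
  qed
  show "(localized q b x)\<^sup>2 \<le> localized q b (x * x)"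
  proof (rule LIMSEQ_le[OF tendsto_power[OF L] L2], intro exI allI impI)
    fix n
    show "(q (x * b ^ n) / q b ^ n)\<^sup>2 \<le> q ((x * x) * b ^ (2 * n)) / q b ^ (2 * n)"
      unfolding split useminorm_square[OF q]
      by (simp add: power_divide power_mult[symmetric] mult.commute)
  qed
qed

end

section \<open>Minimal seminorms are multiplicative\<close>

lemma uniform_seminorm_chain_Inf:
  assumes C: "\<And>q. q \<in> C \<Longrightarrow> uniform_seminorm q" and ne: "C \<noteq> {}"
    and chain: "\<And>q r. q \<in> C \<Longrightarrow> r \<in> C \<Longrightarrow> q \<le> r \<or> r \<le> q"
  shows "uniform_seminorm (\<lambda>x. INF q\<in>C. q x)"
proof -
  define r where "r x = (INF q\<in>C. q x)" for x
  have bdd: "bdd_below ((\<lambda>q. q x) ` C)" for x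
    using useminorm_nonneg[OF C] by (intro bdd_belowI[of _ 0]) auto
  have le: "r x \<le> q x" if "q \<in> C" for q x
    unfolding r_def using bdd that by (rule cINF_lower)
  have ge: "t \<le> r x" if "\<And>q. q \<in> C \<Longrightarrow> t \<le> q x" for t x
    unfolding r_def using ne that by (rule cINF_greatest)
  have nn: "0 \<le> r x" for x
    using useminorm_nonneg[OF C] by (intro ge)
  \<comment> \<open>In a chain, estimates involving \<open>q1 x\<close> and \<open>q2 y\<close>
    reduce to a single seminorm below both; the two infima are then taken one at a time.\<close>
  have "\<exists>q\<in>C. q x \<le> q1 x \<and> q y \<le> q2 y" if "q1 \<in> C" "q2 \<in> C" for q1 q2 x y
    using chain[OF that] that by (meson le_fun_def order_refl)
  note common = this
  have "r (x + y) \<le> r x + r y" for x y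
  proof -
    have "r (x + y) - q2 y \<le> q1 x" if q12: "q1 \<in> C" "q2 \<in> C" for q1 q2
    proof -
      obtain q where "q \<in> C" "q x \<le> q1 x" "q y \<le> q2 y"
        using common[OF q12] by blast
      then show ?thesis
        using le[of q "x + y"] useminorm_add[OF C, of q x y] by linarith
    qed
    then have "r (x + y) - q2 y \<le> r x" if "q2 \<in> C" for q2
      using that by (auto intro!: ge)
    then have "r (x + y) - r x \<le> q2 y" if "q2 \<in> C" for q2
      using that by (smt (verit))
    then show ?thesis
      using ge[of "r (x + y) - r x" y] by simp
  qed
  moreover have "r (x * y) \<le> r x * r y" for x y
  proof -
    have mult_ge: "t \<le> s * r x" if "\<And>q. q \<in> C \<Longrightarrow> t \<le> s * q x" "0 \<le> s" for s t x
    proof (cases "s = 0")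
      case True
      then show ?thesis using that ne by auto
    next
      case False
      then have "t / s \<le> r x"
        using that by (intro ge) (simp add: field_simps)
      then show ?thesis
        using False that by (simp add: field_simps)
    qed
    have "r (x * y) \<le> q1 x * q2 y" if q12: "q1 \<in> C" "q2 \<in> C" for q1 q2
    proof -
      obtain q where q: "q \<in> C" "q x \<le> q1 x" "q y \<le> q2 y"
        using common[OF q12] by blast
      have "r (x * y) \<le> q x * q y"
        using le[of q "x * y"] q(1) useminorm_mult[OF C, of q x y] by linarith
      also have "\<dots> \<le> q1 x * q2 y"
        using q q12 C by (intro mult_mono useminorm_nonneg) auto
      finally show ?thesis .
    qed
    then have "r (x * y) \<le> q1 x * r y" if "q1 \<in> C" for q1
      using that C by (intro mult_ge) (auto intro: useminorm_nonneg)
    then have "r (x * y) \<le> r y * r x"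
      using nn by (intro mult_ge) (auto simp: mult.commute)
    then show ?thesis by (simp add: mult.commute)
  qed
  moreover have "r (scaleC c x) \<le> cmod c * r x" for c x
  proof (cases "c = 0")
    case True
    obtain q where "q \<in> C" using ne by blast
    then show ?thesis
      using True le[of q 0] useminorm_zero[OF C, of q] by simp
  next
    case False
    have "r (scaleC c x) / cmod c \<le> q x" if "q \<in> C" for q
      using le[OF that, of "scaleC c x"] useminorm_scale[OF C[OF that], of c x] False
      by (simp add: field_simps)
    then have "r (scaleC c x) / cmod c \<le> r x"
      by (rule ge)
    then show ?thesis
      using False by (simp add: field_simps)
  qed
  moreover have "(r x)\<^sup>2 \<le> r (x * x)" for x
  proof (rule ge)
    fix q assume "q \<in> C"
    then show "(r x)\<^sup>2 \<le> q (x * x)"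
      using useminorm_square[OF C] le nn by (metis power_mono)
  qed
  ultimately show ?thesis
    using nn unfolding uniform_seminorm_def r_def by blast
qed

text \<open>A minimal uniform seminorm with a prescribed value at \<open>a\<close> is fixed by localization, first
  at \<open>a\<close> and then at every other element, and hence is multiplicative.\<close>

lemma multiplicative_seminorm_exists:
  assumes p: "uniform_seminorm p" and a: "p a \<noteq> 0"
  obtains q where "uniform_seminorm q" "\<And>x. q x \<le> p x" "q a = p a" "\<And>x y. q (x * y) = q x * q y"
proof -
  define A where "A = {q. uniform_seminorm q \<and> q \<le> p \<and> q a = p a}"
  have pA: "p \<in> A"
    using p by (simp add: A_def)
  \<comment> \<open>Zorn's lemma in the reversed pointwise order: its maximal elements are minimal
    seminorms, and a nonempty chain is bounded by its pointwise infimum.\<close>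
  have "\<exists>m\<in>A. \<forall>q\<in>A. q \<le> m \<longrightarrow> q = m"
  proof (rule predicate_Zorn[of A "\<lambda>q r. r \<le> q"])
    show "partial_order_on A (relation_of (\<lambda>q r. r \<le> q) A)"
      by (rule partial_order_on_relation_ofI) auto
  next
    fix C assume C: "C \<in> Chains (relation_of (\<lambda>q r. r \<le> q) A)"
    show "\<exists>u\<in>A. \<forall>q\<in>C. u \<le> q"
    proof (cases "C = {}")
      case True
      then show ?thesis using pA by blast
    next
      case False
      have CA: "q \<in> A" if "q \<in> C" for q
        using C that by (auto simp: Chains_def relation_of_def)
      have chain: "q \<le> r \<or> r \<le> q" if "q \<in> C" "r \<in> C" for q r
        using C that by (auto simp: Chains_def relation_of_def)
      let ?r = "\<lambda>x. INF q\<in>C. q x"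
      have le: "?r x \<le> q x" if "q \<in> C" for q x
      proof (rule cINF_lower[OF _ that])
        show "bdd_below ((\<lambda>q. q x) ` C)"
          using useminorm_nonneg CA by (intro bdd_belowI[of _ 0]) (auto simp: A_def)
      qed
      have "uniform_seminorm ?r"
        using CA chain False by (intro uniform_seminorm_chain_Inf) (auto simp: A_def)
      moreover have "?r \<le> p"
      proof -
        obtain q where "q \<in> C" using False by blast
        then show ?thesis
          using le[of q] CA[of q] by (auto simp: A_def le_fun_def intro: order_trans)
      qed
      moreover have "?r a = p a"
      proof -
        have "(\<lambda>q. q a) ` C = {p a}"
          using CA False by (auto simp: A_def image_def)
        then show ?thesis by simp
      qed
      ultimately show ?thesis
        using le by (intro bexI[of _ ?r]) (auto simp: A_def le_fun_def)
    qed
  qed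
  then obtain q where "q \<in> A" and min: "\<And>r. r \<in> A \<Longrightarrow> r \<le> q \<Longrightarrow> r = q"
    by blast
  then have q: "uniform_seminorm q" and qp: "q \<le> p" and qa: "q a = p a"
    by (auto simp: A_def)
  note nn = useminorm_nonneg[OF q]
  \<comment> \<open>If localizing at \<open>b\<close> preserves the value at \<open>a\<close>, the
    result lies in \<open>A\<close>, so minimality makes it equal to \<open>q\<close>; the term
    \<open>n = 1\<close> of the decreasing sequence then gives
    \<open>q x * q b \<le> q (x * b)\<close>.\<close>
  have fixed: "q (x * b) = q x * q b" if b: "q b \<noteq> 0" and La: "localized q b a = q a" for b x
  proof -
    have le: "localized q b \<le> q"
      using localized_le[OF q b, of _ 0] by (simp add: le_fun_def)
    then have "localized q b \<in> A"
      using uniform_seminorm_localized[OF q b] qp qa La by (auto simp: A_def)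
    then have "localized q b = q"
      using le by (rule min)
    then have "q x \<le> q (x * b) / q b"
      using localized_le[OF q b, of x 1] by simp
    then show ?thesis
      using useminorm_mult[OF q, of x b] b nn[of b] by (simp add: field_simps)
  qed
  have a_ne: "q a \<noteq> 0"
    using a qa by simp
  have "localized q a a = q a"
  proof -
    have "q (a * a ^ n) / q a ^ n = q a" for n
      using useminorm_power[OF q a_ne, of "Suc n"] a_ne by simp
    then show ?thesis
      unfolding localized_def by simp
  qed
  then have mult_a: "q (x * a) = q x * q a" for x
    using fixed[OF a_ne] by blast
  have "q (x * b) = q x * q b" for x b
  proof (cases "q b = 0")
    case True
    then show ?thesis
      using useminorm_mult[OF q, of x b] nn[of "x * b"] by simp
  next
    case False
    \<comment> \<open>Multiplicativity in the factor \<open>a\<close> makes every quotient in the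
      limit equal to \<open>q a\<close>, so localizing at any other \<open>b\<close> also preserves
      the value at \<open>a\<close>.\<close>
    have "q (a * b ^ n) / q b ^ n = q a" for n
      using mult_a[of "b ^ n"] useminorm_power[OF q False, of n] False by (simp add: mult.commute)
    then have "localized q b a = q a"
      unfolding localized_def by simp
    then show ?thesis
      using fixed[OF False] by blast
  qed
  then show thesis
    using that[of q] q qp qa by (auto simp: le_fun_def)
qed

section \<open>Multiplicative seminorms and the distance to the scalars\<close>

text \<open>Gelfand--Mazur, by the argument of Ostrowski: if \<open>m > 0\<close> is the distance from \<open>x\<close> to the
  scalars, attained at \<open>\<kappa>\<close>, factoring \<open>x^N - \<mu>^N\<close> for \<open>N = 2^k\<close> shows that the distance from \<open>x\<close> to \<open>\<kappa> + \<mu>\<close> is at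
  most \<open>m (1 + (\<bar>\<mu>\<bar> / m)^N)\<close>. So it is still \<open>m\<close> if \<open>\<bar>\<mu>\<bar> < m\<close>, and iterating this, the distance does not
  tend to infinity with \<open>\<kappa>\<close>.\<close>

lemma multiplicative_seminorm_scalar:
  assumes q: "uniform_seminorm q" and one: "q 1 = 1" and mult: "\<And>x y. q (x * y) = q x * q y"
  shows "\<exists>\<kappa>. q (x - scaleC \<kappa> 1) = 0"
proof (rule ccontr)
  define f where "f \<kappa> = q (x - scaleC \<kappa> 1)" for \<kappa>
  assume "\<nexists>\<kappa>. q (x - scaleC \<kappa> 1) = 0"
  then have f_pos: "0 < f \<kappa>" for \<kappa>
    using useminorm_nonneg[OF q, of "x - scaleC \<kappa> 1"] by (auto simp: f_def order_le_less)
  have f_lower: "cmod \<kappa> - q x \<le> f \<kappa>" for \<kappa>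
    using useminorm_diff[OF q, of x "x - scaleC \<kappa> 1"] by (simp add: useminorm_scale[OF q] one f_def)
  have f_lip: "f \<kappa> - f \<mu> \<le> cmod (\<mu> - \<kappa>)" for \<kappa> \<mu>
    using useminorm_add[OF q, of "x - scaleC \<mu> 1" "scaleC (\<mu> - \<kappa>) 1"]
    by (simp only: useminorm_scale[OF q] f_def) (simp add: one scale_left_diff_distrib)
  have cont: "continuous_on S f" for S
    unfolding continuous_on_iff
  proof (intro ballI allI impI)
    fix \<kappa> :: complex and e :: real assume "0 < e"
    then show "\<exists>d>0. \<forall>\<mu>\<in>S. dist \<mu> \<kappa> < d \<longrightarrow> dist (f \<mu>) (f \<kappa>) < e"
      using f_lip[of \<kappa>] f_lip[of _ \<kappa>]
      by (intro exI[of _ e]) (smt (verit) dist_commute dist_norm dist_real_def)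
  qed
  \<comment> \<open>Outside the disc of radius \<open>q x + f 0\<close> the bound
    \<open>f_lower\<close> keeps \<open>f\<close> above \<open>f 0\<close>, so the minimum over the
    compact disc is global.\<close>
  obtain z where z_le: "\<And>\<kappa>. f z \<le> f \<kappa>"
  proof -
    obtain z where z: "z \<in> cball 0 (q x + f 0)" "\<And>\<kappa>. \<kappa> \<in> cball 0 (q x + f 0) \<Longrightarrow> f z \<le> f \<kappa>"
      using continuous_attains_inf[OF compact_cball _ cont, of 0 "q x + f 0"]
        useminorm_nonneg[OF q, of x] f_pos[of 0] by auto
    have "f z \<le> f \<kappa>" for \<kappa>
    proof (cases "\<kappa> \<in> cball 0 (q x + f 0)")
      case False
      then have "f 0 \<le> f \<kappa>"
        using f_lower[of \<kappa>] by simp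
      moreover have "f z \<le> f 0"
        using useminorm_nonneg[OF q, of x] f_pos[of 0] by (intro z) auto
      ultimately show ?thesis by linarith
    qed (use z in auto)
    then show thesis by (rule that)
  qed
  define m where "m = f z"
  have m: "0 < m" "\<And>\<kappa>. m \<le> f \<kappa>"
    using f_pos z_le by (auto simp: m_def)
  have step: "f (\<kappa> + \<mu>) = m" if \<kappa>: "f \<kappa> = m" and \<mu>: "cmod \<mu> < m" for \<kappa> \<mu>
  proof -
    define y where "y = x - scaleC \<kappa> 1"
    have qy: "q y = m"
      using \<kappa> by (simp add: y_def f_def)
    have y_shift: "q (y - scaleC \<nu> 1) = f (\<kappa> + \<nu>)" for \<nu>
      by (simp add: y_def f_def scale_left_distrib algebra_simps)
    have factor: "q (y ^ 2 ^ Suc k - scaleC (\<nu>\<^sup>2) 1)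
        = q (y ^ 2 ^ k - scaleC \<nu> 1) * q (y ^ 2 ^ k - scaleC (- \<nu>) 1)" for k \<nu>
    proof -
      define w where "w = y ^ 2 ^ k"
      have "(w - scaleC \<nu> 1) * (w - scaleC (- \<nu>) 1) = w * w - scaleC (\<nu>\<^sup>2) 1"
        by (simp add: algebra_simps scale_mult[symmetric] scale_mult'[symmetric] power2_eq_square)
      moreover have "y ^ 2 ^ Suc k = w * w"
        by (simp add: w_def power_add[symmetric] mult_2)
      ultimately show ?thesis
        using mult by (metis w_def)
    qed
    \<comment> \<open>Every complex number has a square root, so each difference at stage
      \<open>Suc k\<close> splits into two factors of stage \<open>k\<close>.\<close>
    have lower: "m ^ 2 ^ k \<le> q (y ^ 2 ^ k - scaleC \<nu> 1)" for k \<nu>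
    proof (induction k arbitrary: \<nu>)
      case 0
      then show ?case using m by (simp add: y_shift)
    next
      case (Suc k)
      have "m ^ 2 ^ Suc k = m ^ 2 ^ k * m ^ 2 ^ k"
        by (simp add: power_add[symmetric] mult_2)
      also have "\<dots> \<le> q (y ^ 2 ^ k - scaleC (csqrt \<nu>) 1) * q (y ^ 2 ^ k - scaleC (- csqrt \<nu>) 1)"
        using m by (intro mult_mono Suc useminorm_nonneg[OF q]) auto
      also have "\<dots> = q (y ^ 2 ^ Suc k - scaleC \<nu> 1)"
        using factor[of k "csqrt \<nu>"] by simp
      finally show ?case .
    qed
    \<comment> \<open>Here the square roots are powers of \<open>\<mu>\<close>: one factor is
      treated by induction, the other is estimated from below by \<open>lower\<close>.\<close>
    have "f (\<kappa> + \<mu>) * m ^ 2 ^ k \<le> m * q (y ^ 2 ^ k - scaleC (\<mu> ^ 2 ^ k) 1)" for k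
    proof (induction k)
      case 0
      then show ?case by (simp add: y_shift mult.commute)
    next
      case (Suc k)
      let ?\<nu> = "\<mu> ^ 2 ^ k"
      have "f (\<kappa> + \<mu>) * m ^ 2 ^ Suc k = (f (\<kappa> + \<mu>) * m ^ 2 ^ k) * m ^ 2 ^ k"
        by (simp add: power_add[symmetric] mult_2 mult.assoc)
      also have "\<dots> \<le> (m * q (y ^ 2 ^ k - scaleC ?\<nu> 1)) * q (y ^ 2 ^ k - scaleC (- ?\<nu>) 1)"
        using m by (intro mult_mono Suc lower useminorm_nonneg[OF q] mult_nonneg_nonneg) auto
      also have "\<dots> = m * q (y ^ 2 ^ Suc k - scaleC (\<mu> ^ 2 ^ Suc k) 1)"
        using factor[of k ?\<nu>] by (simp add: power_mult[symmetric] mult.commute mult.left_commute)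
      finally show ?case .
    qed
    note iter = this
    have "f (\<kappa> + \<mu>) \<le> m * (1 + (cmod \<mu> / m) ^ k)" if "k \<in> range ((^) 2)" for k :: nat
    proof -
      from that obtain j where k: "k = 2 ^ j" by auto
      have "q (y ^ k) \<le> m ^ k"
        using useminorm_power_le[OF q one, of y k] qy by simp
      then have "q (y ^ k - scaleC (\<mu> ^ k) 1) \<le> m ^ k + cmod \<mu> ^ k"
        using useminorm_diff[OF q, of "y ^ k" "scaleC (\<mu> ^ k) 1"]
        by (simp add: useminorm_scale[OF q] one norm_power)
      then have "m * q (y ^ k - scaleC (\<mu> ^ k) 1) \<le> m * (m ^ k + cmod \<mu> ^ k)"
        using m by simp
      then have "f (\<kappa> + \<mu>) * m ^ k \<le> m * (m ^ k + cmod \<mu> ^ k)"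
        using iter[of j] k by simp
      then show ?thesis
        using m by (simp add: field_simps power_divide)
    qed
    note bound = this
    have "(\<lambda>k. m * (1 + (cmod \<mu> / m) ^ 2 ^ k)) \<longlonglongrightarrow> m * (1 + 0)"
    proof (intro tendsto_intros)
      have "(\<lambda>k. (cmod \<mu> / m) ^ k) \<longlonglongrightarrow> 0"
        using \<mu> m by (intro LIMSEQ_realpow_zero) auto
      from LIMSEQ_subseq_LIMSEQ[OF this, of "\<lambda>k. 2 ^ k"]
      show "(\<lambda>k. (cmod \<mu> / m) ^ 2 ^ k) \<longlonglongrightarrow> 0"
        by (simp add: o_def strict_mono_def)
    qed
    then have "f (\<kappa> + \<mu>) \<le> m * (1 + 0)"
      by (rule LIMSEQ_le_const) (auto intro!: bound)
    then show ?thesis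
      using m(2)[of "\<kappa> + \<mu>"] by simp
  qed
  \<comment> \<open>Steps of length \<open>m / 2 < m\<close> are admissible for \<open>step\<close>,
    so \<open>f\<close> stays at \<open>m\<close> along a progression that leaves every disc,
    against \<open>f_lower\<close>.\<close>
  have "f (z + of_nat n * of_real (m / 2)) = m" for n
  proof (induction n)
    case (Suc n)
    then show ?case
      using step[OF Suc, of "of_real (m / 2)"] m by (simp add: algebra_simps add_divide_distrib)
  qed (simp add: m_def)
  then have "cmod (z + of_nat n * of_real (m / 2)) \<le> m + q x" for n
    using f_lower by (metis diff_le_eq)
  moreover have "real n * (m / 2) - cmod z \<le> cmod (z + of_nat n * of_real (m / 2))" for n
  proof -
    have "cmod (of_nat n * of_real (m / 2)) = real n * (m / 2)"
      using m by (simp add: norm_mult)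
    then show ?thesis
      using norm_triangle_ineq2[of "of_nat n * of_real (m / 2)" "- z"] by (simp add: add.commute)
  qed
  ultimately have "real n * (m / 2) \<le> m + q x + cmod z" for n
    by (smt (verit))
  moreover obtain n where "m + q x + cmod z < real n * (m / 2)"
    using m by (metis half_gt_zero reals_Archimedean3)
  ultimately show False
    by (meson not_less)
qed

section \<open>Characters\<close>

definition character :: "('a \<Rightarrow> complex) \<Rightarrow> bool" where
  "character \<omega> \<longleftrightarrow> \<omega> 1 = 1 \<and> (\<forall>x y. \<omega> (x + y) = \<omega> x + \<omega> y) \<and>
     (\<forall>c x. \<omega> (scaleC c x) = c * \<omega> x) \<and> (\<forall>x y. \<omega> (x * y) = \<omega> x * \<omega> y)"

text \<open>Take a multiplicative seminorm \<open>q \<le> p\<close> with \<open>q a = p a\<close>.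
  Gelfand-Mazur assigns to each \<open>x\<close> a scalar \<open>\<omega> x\<close> at
  \<open>q\<close>-distance 0. As \<open>q 1 = 1\<close>, this scalar is unique, so each law of a
  character follows by exhibiting a candidate at distance 0.\<close>

lemma character_attains_seminorm:
  assumes p: "uniform_seminorm p" and a: "p a \<noteq> 0"
  obtains \<omega> where "character \<omega>" "\<And>x. cmod (\<omega> x) \<le> p x" "cmod (\<omega> a) = p a"
proof -
  obtain q where q: "uniform_seminorm q" and qp: "\<And>x. q x \<le> p x" and qa: "q a = p a"
    and mult: "\<And>x y. q (x * y) = q x * q y"
    using multiplicative_seminorm_exists[OF p a] by metis
  have one: "q 1 = 1"
    using useminorm_one[OF q, of a] a qa by simp
  obtain \<omega> where \<omega>: "\<And>x. q (x - scaleC (\<omega> x) 1) = 0"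
    using multiplicative_seminorm_scalar[OF q one mult] by metis
  have unique: "\<omega> x = c" if "q (x - scaleC c 1) \<le> 0" for x c
  proof -
    have "scaleC (\<omega> x - c) 1 = (x - scaleC c 1) - (x - scaleC (\<omega> x) 1)"
      by (simp add: scale_left_diff_distrib)
    then have "cmod (\<omega> x - c) \<le> q (x - scaleC c 1) + q (x - scaleC (\<omega> x) 1)"
      using useminorm_diff[OF q] useminorm_scale[OF q, of "\<omega> x - c" 1] one by (metis mult_1_right)
    then have "cmod (\<omega> x - c) \<le> 0"
      using that \<omega>[of x] by linarith
    then show ?thesis by simp
  qed
  have abs: "cmod (\<omega> x) = q x" for x
    using useminorm_diff[OF q, of x "x - scaleC (\<omega> x) 1"]
      useminorm_add[OF q, of "x - scaleC (\<omega> x) 1" "scaleC (\<omega> x) 1"] \<omega>[of x]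
    by (simp add: useminorm_scale[OF q] one)
  have "character \<omega>"
    unfolding character_def
  proof (intro conjI allI)
    show "\<omega> 1 = 1"
      by (rule unique) (simp add: useminorm_zero[OF q])
  next
    fix x y
    have "x + y - scaleC (\<omega> x + \<omega> y) 1 = (x - scaleC (\<omega> x) 1) + (y - scaleC (\<omega> y) 1)"
      by (simp add: scale_left_distrib)
    then show "\<omega> (x + y) = \<omega> x + \<omega> y"
      using useminorm_add[OF q, of "x - scaleC (\<omega> x) 1" "y - scaleC (\<omega> y) 1"] \<omega>
      by (intro unique) (metis add_0)
  next
    fix c x
    have "scaleC c x - scaleC (c * \<omega> x) 1 = scaleC c (x - scaleC (\<omega> x) 1)"
      by (simp add: scale_right_diff_distrib)
    then show "\<omega> (scaleC c x) = c * \<omega> x"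
      using \<omega> by (intro unique) (simp add: useminorm_scale[OF q])
  next
    fix x y
    have "x * y - scaleC (\<omega> x * \<omega> y) 1
        = x * (y - scaleC (\<omega> y) 1) + scaleC (\<omega> y) (x - scaleC (\<omega> x) 1)"
      by (simp add: scale_right_diff_distrib right_diff_distrib scale_mult'[symmetric] mult.commute)
    then show "\<omega> (x * y) = \<omega> x * \<omega> y"
      using useminorm_add[OF q, of "x * (y - scaleC (\<omega> y) 1)" "scaleC (\<omega> y) (x - scaleC (\<omega> x) 1)"] \<omega>
      by (intro unique) (simp add: useminorm_scale[OF q] mult)
  qed
  then show thesis
    using that abs qp qa by metis
qed

end

section \<open>Barrels in algebras of continuous functions\<close>

lemma continuous_map_euclidean_iff_tendsto:
  "continuous_map X euclidean f \<longleftrightarrow> (\<forall>x\<in>topspace X. (f \<longlongrightarrow> f x) (atin X x))"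
  by (simp add: continuous_map_atin)

lemma compact_open_basis:
  assumes "openin (compact_open X) V" "f \<in> V"
  obtains K e where "compactin X K" "0 < e"
    "\<And>g. g \<in> cfun X \<Longrightarrow> (\<And>x. x \<in> K \<Longrightarrow> dist (f x) (g x) < e) \<Longrightarrow> g \<in> V"
proof -
  have "\<exists>K e. compactin X K \<and> 0 < e \<and> (\<forall>g\<in>cfun X. (\<forall>x\<in>K. dist (f x) (g x) < e) \<longrightarrow> g \<in> V)"
    using openin_topology_generated_by[OF assms(1)[unfolded compact_open_def]] assms(2)
  proof (induction arbitrary: f)
    case Empty
    then show ?case by simp
  next
    case (Int V W)
    obtain K d where "compactin X K" "0 < d"
      "\<forall>g\<in>cfun X. (\<forall>x\<in>K. dist (f x) (g x) < d) \<longrightarrow> g \<in> V"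
      using Int.IH(1)[of f] Int.prems by blast
    moreover obtain L e where "compactin X L" "0 < e"
      "\<forall>g\<in>cfun X. (\<forall>x\<in>L. dist (f x) (g x) < e) \<longrightarrow> g \<in> W"
      using Int.IH(2)[of f] Int.prems by blast
    ultimately show ?case
      by (intro exI[of _ "K \<union> L"] exI[of _ "min d e"]) (auto intro: compactin_Un)
  next
    case (UN \<V>)
    then obtain V where "V \<in> \<V>" "f \<in> V" by blast
    with UN.IH show ?case by (meson UnionI)
  next
    case (Basis V)
    then obtain h K e where V: "V = {g \<in> cfun X. \<forall>x\<in>K. dist (h x) (g x) < e}"
      and h: "h \<in> cfun X" and K: "compactin X K" and e: "0 < e"
      by blast
    \<comment> \<open>The generating ball is centred at \<open>h\<close>, not at \<open>f\<close>.
      On the compact set \<open>K\<close>, \<open>dist (h x) (f x)\<close> attains a maximum below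
      \<open>e\<close>; the gap is a radius around \<open>f\<close>.\<close>
    obtain d where d: "0 < d" "\<And>x. x \<in> K \<Longrightarrow> dist (h x) (f x) + d \<le> e"
    proof (cases "K = {}")
      case True
      then show ?thesis using that[of 1] by simp
    next
      case False
      have "continuous_map X euclideanreal (\<lambda>x. dist (h x) (f x))"
        using h Basis(2) unfolding V cfun_def continuous_map_euclidean_iff_tendsto
        by (auto intro!: tendsto_intros)
      then have "compact ((\<lambda>x. dist (h x) (f x)) ` K)"
        using image_compactin[OF K] by fastforce
      then obtain x0 where "x0 \<in> K" "\<And>x. x \<in> K \<Longrightarrow> dist (h x) (f x) \<le> dist (h x0) (f x0)"
        using compact_attains_sup[of "(\<lambda>x. dist (h x) (f x)) ` K"] False by auto
      then show ?thesis
        using Basis(2) V by (intro that[of "e - dist (h x0) (f x0)"]) fastforce+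
    qed
    have "dist (h x) (g x) < e" if "dist (f x) (g x) < d" "x \<in> K" for g x
      using d(2)[OF that(2)] that(1) dist_triangle[of "h x" "g x" "f x"] by linarith
    then show ?case
      unfolding V using K d(1) by blast
  qed
  then show thesis
    using that by blast
qed

section \<open>Barrels and Baire category\<close>

context topological_star_algebra
begin

lemma closed_scale_vimage:
  assumes "closed B"
  shows "closed {x. scaleC c x \<in> B}"
proof -
  have "continuous_on UNIV (\<lambda>x. (\<lambda>(c, x). scaleC c x) (c, x))"
    by (rule continuous_on_compose2[OF continuous_scale]) (auto intro!: continuous_intros)
  then have "closed ((\<lambda>x. scaleC c x) -` B)"
    using closed_vimage[OF assms, of "scaleC c"] by simp
  then show ?thesis
    by (simp add: vimage_def)
qed

context
  fixes B assumes B: "barrel scaleC B"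
begin

lemma barrel_convex: "x \<in> B \<Longrightarrow> y \<in> B \<Longrightarrow> cmod a + cmod b \<le> 1 \<Longrightarrow> scaleC a x + scaleC b y \<in> B"
  using B unfolding barrel_def absolutely_convex_def by blast

lemma barrel_balanced: "x \<in> B \<Longrightarrow> cmod c \<le> 1 \<Longrightarrow> scaleC c x \<in> B"
  using barrel_convex[of x x c 0] by simp

lemma barrel_add_half: "scaleC 2 x \<in> B \<Longrightarrow> scaleC 2 y \<in> B \<Longrightarrow> x + y \<in> B"
  using barrel_convex[of "scaleC 2 x" "scaleC 2 y" "1/2" "1/2"] by simp

lemma barrel_absorbs: "\<exists>k. scaleC (1 / of_nat (Suc k)) x \<in> B"
proof -
  obtain r where "0 < r" and r: "\<And>c. cmod c \<ge> r \<Longrightarrow> x \<in> scaleC c ` B"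
    using B unfolding barrel_def absorbing_def by blast
  obtain k where "r \<le> real k"
    using real_arch_simple by blast
  then have "x \<in> scaleC (of_nat (Suc k)) ` B"
    by (intro r) (simp del: of_nat_Suc)
  then show ?thesis
    by (auto intro!: exI[of _ k] simp del: of_nat_Suc)
qed

text \<open>Baire's theorem on the Cantor space \<open>nat \<Rightarrow> bool\<close>: if every multiple of \<open>B\<close> missed the image
  of some point in every cylinder, nested cylinders would shrink to a point whose image is in no
  multiple of \<open>B\<close>.\<close>

lemma barrel_absorbs_subseries:
  fixes T :: "(nat \<Rightarrow> bool) \<Rightarrow> 'a" and g :: "nat \<Rightarrow> 'a"
  assumes cont: "\<And>t U. open U \<Longrightarrow> T t \<in> U \<Longrightarrow> \<exists>N. \<forall>t'. (\<forall>n<N. t' n = t n) \<longrightarrow> T t' \<in> U"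
    and diff: "\<And>t n. T (t(n := True)) - T (t(n := False)) = g n"
  shows "\<exists>k N. \<forall>n\<ge>N. scaleC (1 / of_nat (Suc k)) (g n) \<in> B"
proof -
  define D where "D k = {x. scaleC (1 / of_nat (Suc k)) x \<in> B}" for k
  have D_closed: "closed (D k)" for k
    unfolding D_def using B by (intro closed_scale_vimage) (simp add: barrel_def)
  have "\<exists>k N t. \<forall>t'. (\<forall>n<N. t' n = t n) \<longrightarrow> T t' \<in> D k"
  proof (rule ccontr)
    assume "\<not> ?thesis"
    then have escape: "\<exists>t'. (\<forall>n<N. t' n = t n) \<and> T t' \<notin> D k" for k N t
      by blast
    \<comment> \<open>A state is a length and a point, determining a cylinder; step \<open>k\<close>
      passes to a longer cylinder whose image misses \<open>D k\<close>. The conjunct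
      \<open>True\<close> is the invariant in the format of
      \<open>dependent_nat_choice\<close>.\<close>
    have "\<exists>s :: nat \<Rightarrow> nat \<times> (nat \<Rightarrow> bool). \<forall>k. True \<and> fst (s k) < fst (s (Suc k)) \<and>
        (\<forall>n < fst (s k). snd (s (Suc k)) n = snd (s k) n) \<and>
        (\<forall>t. (\<forall>n < fst (s (Suc k)). t n = snd (s (Suc k)) n) \<longrightarrow> T t \<notin> D k)"
    proof (rule dependent_nat_choice)
      fix s :: "nat \<times> (nat \<Rightarrow> bool)" and k
      obtain t where t: "\<forall>n < fst s. t n = snd s n" "T t \<in> - D k"
        using escape[of "fst s" "snd s" k] by auto
      obtain N where N: "\<forall>t'. (\<forall>n<N. t' n = t n) \<longrightarrow> T t' \<in> - D k"
        using cont[OF _ t(2)] D_closed by (auto simp: open_Compl)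
      show "\<exists>s'. True \<and> fst s < fst s' \<and> (\<forall>n < fst s. snd s' n = snd s n) \<and>
          (\<forall>t. (\<forall>n < fst s'. t n = snd s' n) \<longrightarrow> T t \<notin> D k)"
        using t N by (intro exI[of _ "(Suc (max N (fst s)), t)"]) auto
    qed simp
    then obtain s :: "nat \<Rightarrow> nat \<times> (nat \<Rightarrow> bool)" where s: "\<forall>k. True \<and> fst (s k) < fst (s (Suc k)) \<and>
        (\<forall>n < fst (s k). snd (s (Suc k)) n = snd (s k) n) \<and>
        (\<forall>t. (\<forall>n < fst (s (Suc k)). t n = snd (s (Suc k)) n) \<longrightarrow> T t \<notin> D k)"
      by (rule exE)
    have s_mono: "fst (s k) < fst (s (Suc k))" for k
      using s[THEN spec, of k] by (elim conjE)
    have s_step: "\<forall>n < fst (s k). snd (s (Suc k)) n = snd (s k) n" for k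
      using s[THEN spec, of k] by (elim conjE)
    have s_out: "\<forall>t. (\<forall>n < fst (s (Suc k)). t n = snd (s (Suc k)) n) \<longrightarrow> T t \<notin> D k" for k
      using s[THEN spec, of k] by (elim conjE)
    have mono: "fst (s i) \<le> fst (s j)" if "i \<le> j" for i j
      using lift_Suc_mono_le[of "\<lambda>i. fst (s i)", OF less_imp_le[OF s_mono] that] .
    have s_agree: "snd (s j) n = snd (s i) n" if "i \<le> j" "n < fst (s i)" for i j n
      using that
    proof (induction j rule: dec_induct)
      case (step j)
      then show ?case
        using s_step[of j] mono[of i j] by simp
    qed simp
    have s_ge: "k \<le> fst (s k)" for k
      using s_mono by (induction k) (auto intro: Suc_leI le_less_trans)
    \<comment> \<open>The common point of the nested cylinders: stage \<open>Suc n\<close> has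
      already fixed coordinate \<open>n\<close>, because its length is at least
      \<open>Suc n\<close>.\<close>
    define u where "u n = snd (s (Suc n)) n" for n
    have "u n = snd (s k) n" if "n < fst (s k)" for n k
    proof (cases "k \<le> Suc n")
      case True
      then show ?thesis
        using s_agree that by (simp add: u_def)
    next
      case False
      then show ?thesis
        using s_agree[of "Suc n" k n] s_ge[of "Suc n"] by (simp add: u_def)
    qed
    then have "T u \<notin> D k" for k
      using s_out by blast
    then show False
      using barrel_absorbs[of "T u"] by (auto simp: D_def)
  qed
  then obtain k N t where k: "\<And>t'. (\<And>n. n < N \<Longrightarrow> t' n = t n) \<Longrightarrow> T t' \<in> D k"
    by blast
  \<comment> \<open>For \<open>n \<ge> N\<close> both choices of coordinate \<open>n\<close> stay in
    the cylinder, and \<open>g n\<close> is the difference of their images; this costs a factor 2,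
    and \<open>Suc (2 * k + 1) = 2 * Suc k\<close>.\<close>
  have "scaleC (1 / of_nat (Suc (2 * k + 1))) (g n) \<in> B" if "N \<le> n" for n
  proof -
    define c :: complex where "c = 1 / of_nat (Suc k)"
    have c2: "1 / of_nat (Suc (2 * k + 1)) = c / 2"
      by (simp add: c_def field_simps)
    have g: "scaleC (c / 2) (g n)
        = scaleC (1/2) (scaleC c (T (t(n := True)))) + scaleC (- 1/2) (scaleC c (T (t(n := False))))"
      unfolding diff[of t n, symmetric] by (simp add: scale_right_diff_distrib)
    have "scaleC c (T (t(n := b))) \<in> B" for b
      using k[of "t(n := b)"] that by (simp add: D_def c_def)
    then show ?thesis
      unfolding c2 g by (intro barrel_convex) auto
  qed
  then show ?thesis by blast
qed

end

end

section \<open>Coordinates given by an isomorphism with \<open>C(X)\<close>\<close>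

locale cfun_algebra = topological_star_algebra scaleC star
  for scaleC :: "complex \<Rightarrow> 'a \<Rightarrow>
      'a :: {ring, topological_semigroup_mult, uniform_topological_group_add}"
    and star :: "'a \<Rightarrow> 'a" +
  fixes X :: "'x topology" and \<phi> :: "'a \<Rightarrow> 'x \<Rightarrow> complex"
  assumes iso: "star_algebra_iso_cfun scaleC star X \<phi>"
begin

lemma homeo: "homeomorphic_map euclidean (compact_open X) \<phi>"
  using iso by (simp add: star_algebra_iso_cfun_def)

lemma bij_phi: "bij_betw \<phi> UNIV (cfun X)"
  using homeomorphic_eq_everything_map[THEN iffD1, OF homeo] by (simp add: bij_betw_def)

lemma phi_add [simp]: "x \<in> topspace X \<Longrightarrow> \<phi> (a + b) x = \<phi> a x + \<phi> b x"
  using iso by (simp add: star_algebra_iso_cfun_def)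

lemma phi_scale [simp]: "x \<in> topspace X \<Longrightarrow> \<phi> (scaleC c a) x = c * \<phi> a x"
  using iso by (simp add: star_algebra_iso_cfun_def)

lemma phi_zero [simp]: "x \<in> topspace X \<Longrightarrow> \<phi> 0 x = 0"
  using phi_scale[of x 0 0] by simp

lemma phi_diff [simp]: "x \<in> topspace X \<Longrightarrow> \<phi> (a - b) x = \<phi> a x - \<phi> b x"
  using phi_add[of x "a - b" b] by simp

lemma phi_sum [simp]: "x \<in> topspace X \<Longrightarrow> \<phi> (\<Sum>i\<in>I. a i) x = (\<Sum>i\<in>I. \<phi> (a i) x)"
  by (induction I rule: infinite_finite_induct) auto

lemma phi_in_cfun: "\<phi> a \<in> cfun X"
  using bij_phi by (auto simp: bij_betw_def)

lemma tendsto_phi [tendsto_intros]: "x \<in> topspace X \<Longrightarrow> (\<phi> a \<longlongrightarrow> \<phi> a x) (atin X x)"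
  using phi_in_cfun[of a] by (simp add: cfun_def continuous_map_euclidean_iff_tendsto)

lemma phi_eqI:
  assumes "\<And>x. x \<in> topspace X \<Longrightarrow> \<phi> a x = \<phi> b x"
  shows "a = b"
proof -
  have "\<phi> a = \<phi> b"
    using assms phi_in_cfun[of a] phi_in_cfun[of b] by (auto simp: cfun_def intro: extensionalityI)
  then show ?thesis
    using bij_phi by (auto simp: bij_betw_def inj_on_def)
qed

lemma phi_surj:
  assumes "continuous_map X euclidean f"
  obtains a where "\<And>x. x \<in> topspace X \<Longrightarrow> \<phi> a x = f x"
proof -
  have "restrict f (topspace X) \<in> cfun X"
    using assms continuous_map_eq[OF assms, of "restrict f (topspace X)"] by (simp add: cfun_def)
  then obtain a where "\<phi> a = restrict f (topspace X)"
    using bij_phi by (metis bij_betw_def imageE)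
  then show thesis
    by (intro that[of a]) simp
qed

lemma nhd_phi:
  assumes "open U" "a \<in> U"
  obtains K e where "compactin X K" "0 < e"
    "\<And>b. (\<And>x. x \<in> K \<Longrightarrow> dist (\<phi> a x) (\<phi> b x) < e) \<Longrightarrow> b \<in> U"
proof -
  have "openin (compact_open X) (\<phi> ` U)"
    using homeo assms(1) homeomorphic_imp_open_map unfolding open_map_def by (metis open_openin)
  then obtain K e where K: "compactin X K" "0 < e"
    "\<And>g. g \<in> cfun X \<Longrightarrow> (\<And>x. x \<in> K \<Longrightarrow> dist (\<phi> a x) (g x) < e) \<Longrightarrow> g \<in> \<phi> ` U"
    using compact_open_basis[of X "\<phi> ` U" "\<phi> a"] assms(2) by blast
  have "b \<in> U" if "\<And>x. x \<in> K \<Longrightarrow> dist (\<phi> a x) (\<phi> b x) < e" for b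
    using K(3)[OF phi_in_cfun that] bij_phi by (auto simp: bij_betw_def inj_on_def)
  with K(1,2) show thesis
    by (rule that)
qed

lemma zero_in_interiorI:
  assumes K: "compactin X K" and "0 < e" and S: "\<And>b. (\<And>x. x \<in> K \<Longrightarrow> cmod (\<phi> b x) < e) \<Longrightarrow> b \<in> S"
  shows "0 \<in> interior S"
proof -
  define V where "V = {g \<in> cfun X. \<forall>x\<in>K. dist (\<phi> 0 x) (g x) < e}"
  have "openin (compact_open X) V"
    unfolding V_def compact_open_def using assms phi_in_cfun
    by (intro topology_generated_by_Basis) blast
  then have "open {b. \<phi> b \<in> V}"
    using openin_continuous_map_preimage[OF homeomorphic_imp_continuous_map[OF homeo]] by simp
  moreover have "K \<subseteq> topspace X"
    using K by (rule compactin_subset_topspace)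
  then have "{b. \<phi> b \<in> V} \<subseteq> S" "0 \<in> {b. \<phi> b \<in> V}"
    using S \<open>0 < e\<close> phi_in_cfun by (auto simp: V_def dist_norm subset_iff)
  ultimately show ?thesis
    using interiorI by metis
qed

section \<open>Uniform balls inside a barrel\<close>

context
  fixes B assumes B: "barrel scaleC B"
begin

text \<open>Common core of both Baire arguments on \<open>C(X)\<close>. All subseries of
  \<open>g n = (n + 1) a n\<close> converge uniformly where \<open>F\<close> is bounded, hence
  locally and on compact sets, so their sums belong to the algebra and depend continuously on the
  selection of terms. Thus almost all \<open>g n\<close> lie in one multiple of \<open>B\<close>,
  which the factor \<open>n + 1\<close> eventually exceeds.\<close>

lemma barrel_meets_small_sequence:
  assumes F: "continuous_map X euclideanreal F"
    and small: "\<And>n x. x \<in> topspace X \<Longrightarrow> \<bar>F x\<bar> \<le> real n \<Longrightarrow>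
      cmod (\<phi> (a n) x) \<le> (1/2) ^ n / real (Suc n)"
  shows "\<exists>n. a n \<in> B"
proof -
  define g where "g n = scaleC (of_nat (Suc n)) (a n)" for n
  define h where "h t x n = (if t n then \<phi> (g n) x else 0)" for t :: "nat \<Rightarrow> bool" and x n
  define S where "S t x = (\<Sum>n. h t x n)" for t x
  have h_le: "cmod (h t x n) \<le> (1/2) ^ n" if "x \<in> topspace X" "\<bar>F x\<bar> \<le> real n" for t x n
    using small[OF that] that(1)
    by (simp add: h_def g_def norm_mult field_simps del: of_nat_Suc)
  have geometric: "(\<lambda>n. (1/2 :: real) ^ (n + N)) sums (2 * (1/2) ^ N)" for N
    using sums_mult2[OF geometric_sums[of "1/2 :: real"], of "(1/2) ^ N"] by (simp add: power_add)
  have h_tail: "cmod (h t x (n + N)) \<le> (1/2) ^ (n + N)"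
    if "x \<in> topspace X" "\<bar>F x\<bar> \<le> real N" for t x n N
    using that by (intro h_le) auto
  have summable: "summable (h t x)" if x: "x \<in> topspace X" for t x
  proof -
    obtain N where "\<bar>F x\<bar> \<le> real N"
      using real_arch_simple by blast
    then have "summable (\<lambda>n. h t x (n + N))"
      using h_tail[OF x] geometric by (intro summable_comparison_test'[OF sums_summable[OF geometric[of N]]]) auto
    then show ?thesis by simp
  qed
  have tail: "cmod (S t x - (\<Sum>n<N. h t x n)) \<le> 2 * (1/2) ^ N"
    if x: "x \<in> topspace X" "\<bar>F x\<bar> \<le> real N" for t x N
  proof -
    have "S t x - (\<Sum>n<N. h t x n) = (\<Sum>n. h t x (n + N))"
      using suminf_split_initial_segment[OF summable[OF x(1)], of t N] by (simp add: S_def)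
    moreover have "cmod (\<Sum>n. h t x (n + N)) \<le> (\<Sum>n. (1/2) ^ (n + N))"
      using h_tail[OF x] geometric by (intro norm_suminf_le sums_summable) auto
    ultimately show ?thesis
      using sums_unique[OF geometric] by simp
  qed
  have small_power: "\<exists>N. M \<le> real N \<and> 2 * (1/2 :: real) ^ N < e" if "0 < e" for M e
  proof -
    have "0 < e / 2"
      using that by simp
    then obtain n where n: "(1/2 :: real) ^ n < e / 2"
      using real_arch_pow_inv[of "e / 2" "1/2"] by (auto simp del: less_divide_eq_numeral1 zero_less_divide_iff half_gt_zero_iff)
    obtain m where m: "M \<le> real m"
      using real_arch_simple by blast
    have "(1/2 :: real) ^ max m n \<le> (1/2) ^ n"
      by (intro power_decreasing) auto
    then have "2 * (1/2 :: real) ^ max m n < e"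
      using n by linarith
    moreover have "M \<le> real (max m n)"
      using m by linarith
    ultimately show ?thesis by blast
  qed
  have S_cont: "continuous_map X euclidean (S t)" for t
    unfolding continuous_map_euclidean_iff_tendsto
  proof (intro ballI tendstoI)
    fix x and e :: real assume x: "x \<in> topspace X" and e: "0 < e"
    \<comment> \<open>The margin 1 keeps \<open>\<bar>F y\<bar> \<le> real N\<close> for
      \<open>y\<close> near \<open>x\<close>, so one tail estimate serves a whole
      neighborhood.\<close>
    obtain N where N: "\<bar>F x\<bar> + 1 \<le> real N" "2 * (1/2 :: real) ^ N < e / 3"
      using small_power[of "e / 3"] e by auto
    have "((\<lambda>y. \<Sum>n<N. h t y n) \<longlongrightarrow> (\<Sum>n<N. h t x n)) (atin X x)"
      unfolding h_def using x by (intro tendsto_intros tendsto_sum) (auto intro: tendsto_intros)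
    then have "\<forall>\<^sub>F y in atin X x. dist (\<Sum>n<N. h t y n) (\<Sum>n<N. h t x n) < e / 3"
      using e by (intro tendstoD) auto
    moreover have "\<forall>\<^sub>F y in atin X x. dist (F y) (F x) < 1"
      using F x by (intro tendstoD) (auto simp: continuous_map_euclidean_iff_tendsto)
    moreover have "\<forall>\<^sub>F y in atin X x. y \<in> topspace X"
      using x openin_topspace by (auto simp: eventually_atin)
    ultimately show "\<forall>\<^sub>F y in atin X x. dist (S t y) (S t x) < e"
    proof eventually_elim
      case (elim y)
      then have "\<bar>F y\<bar> \<le> real N"
        using N(1) by (simp add: dist_real_def)
      then have "cmod (S t y - (\<Sum>n<N. h t y n)) < e / 3"
        using tail[of y N t] elim(3) N(2) by linarith
      moreover have "cmod (S t x - (\<Sum>n<N. h t x n)) < e / 3"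
        using tail[of x N t] x N by linarith
      ultimately show ?case
        using elim(1) by (intro dist_triangle_third[of _ "\<Sum>n<N. h t y n" e "\<Sum>n<N. h t x n"])
          (auto simp: dist_norm norm_minus_commute)
    qed
  qed
  then have "\<exists>b. \<forall>x\<in>topspace X. \<phi> b x = S t x" for t
    using phi_surj[OF S_cont] by metis
  then obtain T where T: "\<And>t x. x \<in> topspace X \<Longrightarrow> \<phi> (T t) x = S t x"
    by metis
  have "\<exists>k N. \<forall>n\<ge>N. scaleC (1 / of_nat (Suc k)) (g n) \<in> B"
  proof (rule barrel_absorbs_subseries[OF B, of T])
    fix t U assume "open U" "T t \<in> U"
    then obtain K e where K: "compactin X K" and e: "0 < e" and
      U: "\<And>b. (\<And>x. x \<in> K \<Longrightarrow> dist (\<phi> (T t) x) (\<phi> b x) < e) \<Longrightarrow> b \<in> U"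
      using nhd_phi by metis
    have KX: "K \<subseteq> topspace X"
      using K by (rule compactin_subset_topspace)
    have "bounded (F ` K)"
      using image_compactin[OF K F] by (simp add: compact_imp_bounded)
    then obtain M where M: "\<And>x. x \<in> K \<Longrightarrow> \<bar>F x\<bar> \<le> M"
      by (auto simp: bounded_iff)
    obtain N where N: "M \<le> real N" "2 * (1/2 :: real) ^ N < e / 2"
      using small_power[of "e / 2" M] e by auto
    have "T t' \<in> U" if t': "\<forall>n<N. t' n = t n" for t'
    proof (rule U)
      fix x assume x: "x \<in> K"
      have "(\<Sum>n<N. h t' x n) = (\<Sum>n<N. h t x n)"
        using t' by (intro sum.cong) (auto simp: h_def)
      moreover have "\<bar>F x\<bar> \<le> real N"
        using M[OF x] N(1) by linarith
      ultimately have "dist (S t x) (\<Sum>n<N. h t x n) < e / 2" "dist (S t' x) (\<Sum>n<N. h t x n) < e / 2"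
        using tail[of x N t] tail[of x N t'] x KX N(2) by (auto simp: dist_norm subset_iff)
      then have "dist (S t x) (S t' x) < e"
        by (rule dist_triangle_half_l)
      then show "dist (\<phi> (T t) x) (\<phi> (T t') x) < e"
        using x KX by (simp add: T subset_iff)
    qed
    then show "\<exists>N. \<forall>t'. (\<forall>n<N. t' n = t n) \<longrightarrow> T t' \<in> U"
      by blast
  next
    fix t n
    show "T (t(n := True)) - T (t(n := False)) = g n"
    proof (rule phi_eqI)
      fix x assume x: "x \<in> topspace X"
      have "S (t(n := True)) x - S (t(n := False)) x
          = (\<Sum>m. h (t(n := True)) x m - h (t(n := False)) x m)"
        unfolding S_def using x by (intro suminf_diff summable)
      also have "\<dots> = (\<Sum>m. if m = n then \<phi> (g m) x else 0)"
        by (intro suminf_cong) (simp add: h_def)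
      also have "\<dots> = \<phi> (g n) x"
        using sums_unique[OF sums_single[of n "\<lambda>m. \<phi> (g m) x"]] by simp
      finally show "\<phi> (T (t(n := True)) - T (t(n := False))) x = \<phi> (g n) x"
        using x by (simp add: T)
    qed
  qed
  then obtain k N where kN: "\<And>n. N \<le> n \<Longrightarrow> scaleC (1 / of_nat (Suc k)) (g n) \<in> B"
    by blast
  \<comment> \<open>\<open>n \<ge> N\<close> puts \<open>g n\<close> into the multiple, and
    \<open>n \<ge> k\<close> makes the factor \<open>Suc k / Suc n\<close> at most 1, so that
    balancedness applies.\<close>
  define n where "n = max k N"
  have "scaleC (of_nat (Suc k) / of_nat (Suc n)) (scaleC (1 / of_nat (Suc k)) (g n)) \<in> B"
    by (intro barrel_balanced[OF B] kN) (auto simp: n_def norm_divide divide_simps simp del: of_nat_Suc)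
  then have "a n \<in> B"
    by (simp add: g_def del: of_nat_Suc)
  then show ?thesis ..
qed

text \<open>For \<open>F = 0\<close> the smallness condition of
  \<open>barrel_meets_small_sequence\<close> is a uniform bound on \<open>X\<close>; if every ball
  failed, there would be such a sequence outside \<open>B\<close>.\<close>

lemma barrel_contains_uniform_ball:
  obtains \<delta> where "0 < \<delta>" "\<And>a. (\<And>x. x \<in> topspace X \<Longrightarrow> cmod (\<phi> a x) \<le> \<delta>) \<Longrightarrow> a \<in> B"
proof -
  have "\<exists>\<delta>>0. \<forall>a. (\<forall>x\<in>topspace X. cmod (\<phi> a x) \<le> \<delta>) \<longrightarrow> a \<in> B"
  proof (rule ccontr)
    assume "\<not> ?thesis"
    then have neg: "\<And>\<delta>. 0 < \<delta> \<Longrightarrow> \<exists>a. (\<forall>x\<in>topspace X. cmod (\<phi> a x) \<le> \<delta>) \<and> a \<notin> B"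
      by blast
    have "\<exists>a. (\<forall>x\<in>topspace X. cmod (\<phi> a x) \<le> (1/2) ^ n / real (Suc n)) \<and> a \<notin> B" for n
      by (rule neg) simp
    then obtain a where a: "\<And>n x. x \<in> topspace X \<Longrightarrow> cmod (\<phi> (a n) x) \<le> (1/2) ^ n / real (Suc n)"
      and aB: "\<And>n. a n \<notin> B"
      by metis
    have "\<exists>n. a n \<in> B"
      using a by (intro barrel_meets_small_sequence[of "\<lambda>_. 0"]) auto
    then show False
      using aB by blast
  qed
  then show thesis
    using that by blast
qed

section \<open>The support of a barrel\<close>

text \<open>The support is defined by cozero sets \<open>{u \<noteq> 0}\<close> rather than open sets, because \<open>X\<close> need not be
  completely regular.\<close>

definition barrel_null :: "('x \<Rightarrow> real) \<Rightarrow> bool" where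
  "barrel_null u \<longleftrightarrow> continuous_map X euclidean u \<and>
     (\<forall>a. (\<forall>x\<in>topspace X. u x = 0 \<longrightarrow> \<phi> a x = 0) \<longrightarrow> a \<in> B)"

definition barrel_support :: "'x set" where
  "barrel_support = {x \<in> topspace X. \<forall>u. barrel_null u \<longrightarrow> u x = 0}"

text \<open>If \<open>F\<close> is unbounded on the support, the cozero set of
  \<open>max (\<bar>F x\<bar> - n) 0\<close> meets the support for every \<open>n\<close> and so is
  not null. This gives functions outside \<open>B\<close> that vanish where
  \<open>\<bar>F x\<bar> \<le> n\<close>, against
  \<open>barrel_meets_small_sequence\<close>.\<close>

lemma relatively_pseudocompact_barrel_support: "relatively_pseudocompact_in X barrel_support"
  unfolding relatively_pseudocompact_in_def
proof (intro conjI allI impI)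
  show "barrel_support \<subseteq> topspace X"
    by (auto simp: barrel_support_def)
  fix F assume F: "continuous_map X euclideanreal F"
  show "bounded (F ` barrel_support)"
  proof (rule ccontr)
    assume unbounded: "\<not> bounded (F ` barrel_support)"
    have "\<exists>a. (\<forall>x\<in>topspace X. \<bar>F x\<bar> \<le> real n \<longrightarrow> \<phi> a x = 0) \<and> a \<notin> B" for n
    proof -
      define u where "u x = max (\<bar>F x\<bar> - real n) 0" for x
      obtain x where x: "x \<in> barrel_support" "real n < \<bar>F x\<bar>"
        using unbounded unfolding bounded_iff by (auto simp: not_le)
      then have "\<not> barrel_null u"
        by (auto simp: barrel_support_def u_def)
      moreover have "continuous_map X euclidean u"
        using F unfolding u_def continuous_map_euclidean_iff_tendsto by (auto intro!: tendsto_intros)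
      ultimately obtain a where "\<forall>x\<in>topspace X. u x = 0 \<longrightarrow> \<phi> a x = 0" "a \<notin> B"
        unfolding barrel_null_def by blast
      then show ?thesis
        by (intro exI[of _ a]) (auto simp: u_def)
    qed
    then obtain a where a: "\<And>n x. x \<in> topspace X \<Longrightarrow> \<bar>F x\<bar> \<le> real n \<Longrightarrow> \<phi> (a n) x = 0"
      and aB: "\<And>n. a n \<notin> B"
      by metis
    have "\<exists>n. a n \<in> B"
      using a by (intro barrel_meets_small_sequence[OF F]) auto
    then show False
      using aB by blast
  qed
qed

text \<open>Adding two elements costs a factor 2, which is harmless when all multiples of the
  summands lie in \<open>B\<close>.\<close>

lemma barrel_multiples_sum:
  assumes "\<And>i c. i \<in> I \<Longrightarrow> scaleC c (b i) \<in> B"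
  shows "scaleC c (\<Sum>i\<in>I. b i) \<in> B"
  using assms
proof (induction I arbitrary: c rule: infinite_finite_induct)
  case (insert i I)
  have "scaleC c (b i) + scaleC c (\<Sum>i\<in>I. b i) \<in> B"
    using insert by (intro barrel_add_half[OF B]) (auto simp del: scale_sum_right)
  then show ?case
    using insert by (simp add: scale_right_distrib)
qed (use barrel_absorbs[OF B, of 0] in auto)

text \<open>On a compact set \<open>L\<close>, a function vanishing near the support is a finite sum of functions
  vanishing outside null cozero sets, by a partition of unity.\<close>

lemma barrel_contains_if_zero_near_support:
  assumes F: "continuous_map X euclideanreal F"
    and support: "\<And>x. x \<in> barrel_support \<Longrightarrow> F x < r"
    and zero: "\<And>x. x \<in> topspace X \<Longrightarrow> F x < r \<Longrightarrow> \<phi> d x = 0"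
  shows "d \<in> B"
proof (rule ccontr)
  assume "d \<notin> B"
  moreover have "open (- B)"
    using B by (simp add: barrel_def open_Compl)
  \<comment> \<open>As \<open>B\<close> is closed, everything close to \<open>d\<close> on some
    compact \<open>L\<close> lies outside \<open>B\<close>; it remains to find an element of
    \<open>B\<close> that agrees with \<open>d\<close> on \<open>L\<close>.\<close>
  ultimately obtain L e where L: "compactin X L" and e: "0 < e"
    and Le: "\<And>b. (\<And>x. x \<in> L \<Longrightarrow> dist (\<phi> d x) (\<phi> b x) < e) \<Longrightarrow> b \<in> - B"
    using nhd_phi[of "- B" d] by auto
  have LX: "L \<subseteq> topspace X"
    using L by (rule compactin_subset_topspace)
  \<comment> \<open>The part of \<open>L\<close> where \<open>d\<close> can be nonzero. It is
    compact and avoids the support, so finitely many null cozero sets cover it.\<close>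
  define L' where "L' = {x \<in> topspace X. F x \<in> {r..}} \<inter> L"
  have "closedin X {x \<in> topspace X. F x \<in> {r..}}"
    using F by (rule closedin_continuous_map_preimage) auto
  then have L': "compactin X L'"
    unfolding L'_def using L by (rule closed_Int_compactin)
  define \<U> where "\<U> = (\<lambda>u. {x \<in> topspace X. u x \<in> - {0}}) ` Collect barrel_null"
  have "\<And>U. U \<in> \<U> \<Longrightarrow> openin X U"
    unfolding \<U>_def barrel_null_def by (auto simp del: Compl_iff intro!: openin_continuous_map_preimage)
  moreover have "L' \<subseteq> \<Union> \<U>"
  proof
    fix x assume "x \<in> L'"
    then have "x \<in> topspace X" "x \<notin> barrel_support"
      using support[of x] by (auto simp: L'_def)
    then show "x \<in> \<Union> \<U>"
      by (auto simp: barrel_support_def \<U>_def)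
  qed
  ultimately obtain \<F> where "finite \<F>" "\<F> \<subseteq> \<U>" "L' \<subseteq> \<Union> \<F>"
    using compactinD[OF L'] by metis
  moreover from calculation obtain N where N: "N \<subseteq> Collect barrel_null" "finite N"
    and "\<F> = (\<lambda>u. {x \<in> topspace X. u x \<in> - {0}}) ` N"
    unfolding \<U>_def by (elim finite_subset_image[THEN exE]) auto
  ultimately have cover: "L' \<subseteq> (\<Union>u\<in>N. {x \<in> topspace X. u x \<in> - {0}})"
    by simp
  define W where "W x = (\<Sum>u\<in>N. \<bar>u x\<bar>)" for x
  have u_cont: "(u \<longlongrightarrow> u x) (atin X x)" if "u \<in> N" "x \<in> topspace X" for u x
    using that N by (auto simp: barrel_null_def continuous_map_euclidean_iff_tendsto)
  have W_cont: "(W \<longlongrightarrow> W x) (atin X x)" if "x \<in> topspace X" for x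
    unfolding W_def using that by (intro tendsto_intros u_cont)
  have W_pos: "0 < W x" if x: "x \<in> L'" for x
  proof -
    obtain u where "u \<in> N" "u x \<noteq> 0"
      using x cover by auto
    then show ?thesis
      unfolding W_def using N(2) by (intro sum_pos2[of N u]) auto
  qed
  obtain m where m: "0 < m" "\<And>x. x \<in> L' \<Longrightarrow> m \<le> W x"
  proof (cases "L' = {}")
    case True
    then show ?thesis using that[of 1] by simp
  next
    case False
    have "continuous_map X euclideanreal W"
      using W_cont by (simp add: continuous_map_euclidean_iff_tendsto)
    then have "compact (W ` L')"
      using image_compactin[OF L'] by fastforce
    then obtain x0 where "x0 \<in> L'" "\<And>x. x \<in> L' \<Longrightarrow> W x0 \<le> W x"
      using compact_attains_inf[of "W ` L'"] False by auto
    then show ?thesis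
      using that[of "W x0"] W_pos by blast
  qed
  \<comment> \<open>The denominator is \<open>W\<close> on \<open>L'\<close>, where the quotients
    sum to 1, and at least \<open>m > 0\<close> everywhere. Each \<open>b u\<close> vanishes where
    \<open>u\<close> does, as do its multiples, so these lie in \<open>B\<close>.\<close>
  have "\<exists>b. \<forall>x\<in>topspace X. \<phi> b x = \<phi> d x * of_real (\<bar>u x\<bar> / max (W x) m)" if "u \<in> N" for u
  proof -
    have "continuous_map X euclidean (\<lambda>x. \<phi> d x * of_real (\<bar>u x\<bar> / max (W x) m))"
      unfolding continuous_map_euclidean_iff_tendsto using m(1)
      by (auto intro!: tendsto_intros u_cont[OF that] W_cont)
    then show ?thesis
      by (meson phi_surj)
  qed
  then obtain b where b: "\<And>u x. u \<in> N \<Longrightarrow> x \<in> topspace X \<Longrightarrow>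
      \<phi> (b u) x = \<phi> d x * of_real (\<bar>u x\<bar> / max (W x) m)"
    by metis
  have "scaleC c (b u) \<in> B" if "u \<in> N" for c u
    using that N b[OF that] by (auto simp: barrel_null_def)
  then have "scaleC 1 (\<Sum>u\<in>N. b u) \<in> B"
    by (rule barrel_multiples_sum)
  moreover have "(\<Sum>u\<in>N. b u) \<in> - B"
  proof (rule Le)
    fix x assume x: "x \<in> L"
    then have xX: "x \<in> topspace X"
      using LX by blast
    have sum: "\<phi> (\<Sum>u\<in>N. b u) x = \<phi> d x * of_real (W x / max (W x) m)"
      using xX by (simp add: b W_def sum_distrib_left sum_divide_distrib)
    have "\<phi> (\<Sum>u\<in>N. b u) x = \<phi> d x"
    proof (cases "x \<in> L'")
      case True
      then show ?thesis
        unfolding sum using m W_pos[OF True] by (simp add: max_absorb1)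
    next
      case False
      then show ?thesis
        unfolding sum using x xX zero[of x] by (simp add: L'_def)
    qed
    then show "dist (\<phi> d x) (\<phi> (\<Sum>u\<in>N. b u) x) < e"
      using e by simp
  qed
  ultimately show False by simp
qed

lemma barrel_nhd_if_support_compact:
  assumes "relatively_compact_in X barrel_support"
  shows "0 \<in> interior B"
proof -
  obtain \<delta> where \<delta>: "0 < \<delta>" "\<And>a. (\<And>x. x \<in> topspace X \<Longrightarrow> cmod (\<phi> a x) \<le> \<delta>) \<Longrightarrow> a \<in> B"
    using barrel_contains_uniform_ball by blast
  have support: "barrel_support \<subseteq> X closure_of barrel_support"
    by (rule closure_of_subset) (auto simp: barrel_support_def)
  show ?thesis
  proof (rule zero_in_interiorI)
    show "compactin X (X closure_of barrel_support)"
      using assms by (simp add: relatively_compact_in_def)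
    show "0 < \<delta> / 2"
      using \<delta> by simp
    fix a assume small: "\<And>x. x \<in> X closure_of barrel_support \<Longrightarrow> cmod (\<phi> a x) < \<delta> / 2"
    \<comment> \<open>Radial truncation of \<open>\<phi> a\<close> to modulus at most
      \<open>\<delta> / 2\<close>. Smaller values are unchanged, so \<open>a - b\<close> vanishes
      near the support; the half compensates the doubling of \<open>b\<close> in
      \<open>barrel_add_half\<close>.\<close>
    define v where "v x = \<phi> a x * of_real ((\<delta> / 2) / max (\<delta> / 2) (cmod (\<phi> a x)))" for x
    have "continuous_map X euclidean v"
      unfolding continuous_map_euclidean_iff_tendsto v_def using \<delta>(1)
      by (auto intro!: tendsto_intros)
    then obtain b where b: "\<And>x. x \<in> topspace X \<Longrightarrow> \<phi> b x = v x"
      using phi_surj by blast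
    have v_le: "cmod (v x) \<le> \<delta> / 2" for x
      using \<delta>(1) by (auto simp: v_def norm_mult norm_divide max_def divide_simps)
    have "scaleC 2 b \<in> B"
      using v_le by (intro \<delta>(2)) (auto simp: b norm_mult mult.commute)
    moreover have "scaleC 2 (a - b) \<in> B"
    proof (rule barrel_contains_if_zero_near_support)
      show "continuous_map X euclideanreal (\<lambda>x. cmod (\<phi> a x))"
        unfolding continuous_map_euclidean_iff_tendsto by (auto intro!: tendsto_intros)
      show "cmod (\<phi> a x) < \<delta> / 2" if "x \<in> barrel_support" for x
        using small support that by blast
      show "\<phi> (scaleC 2 (a - b)) x = 0" if "x \<in> topspace X" "cmod (\<phi> a x) < \<delta> / 2" for x
        using that \<delta>(1) by (simp add: b v_def max_absorb1)
    qed
    ultimately have "b + (a - b) \<in> B"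
      by (rule barrel_add_half[OF B])
    then show "a \<in> B" by simp
  qed
qed

end

lemma barreled_if_pseudocompact_imp_compact:
  assumes "\<And>A. relatively_pseudocompact_in X A \<Longrightarrow> relatively_compact_in X A"
  shows "barreled scaleC"
  unfolding barreled_def
  using assms barrel_nhd_if_support_compact relatively_pseudocompact_barrel_support by blast

end

section \<open>The spectrum of a commutative pro-C*-algebra\<close>

lemma open_evaluation_vimage: "open W \<Longrightarrow> open ((\<lambda>h :: 'a \<Rightarrow> 'b :: topological_space. h x) -` W)"
  by (intro open_vimage) auto

text \<open>The weaker classes come first because the existing arities, induced by the metric on functions
  with countable domain, have to be generalized from the bottom up.\<close>

instance "fun" :: (type, t0_space) t0_space
proof
  fix f g :: "'a \<Rightarrow> 'b"
  assume "f \<noteq> g"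
  then obtain x where "f x \<noteq> g x" by blast
  then obtain U where "open U" "\<not> (f x \<in> U \<longleftrightarrow> g x \<in> U)"
    using separation_t0 by metis
  then show "\<exists>U. open U \<and> \<not> (f \<in> U \<longleftrightarrow> g \<in> U)"
    by (intro exI[of _ "(\<lambda>h. h x) -` U"]) (auto intro: open_evaluation_vimage)
qed

instance "fun" :: (type, t1_space) t1_space
proof
  fix f g :: "'a \<Rightarrow> 'b"
  assume "f \<noteq> g"
  then obtain x where "f x \<noteq> g x" by blast
  then obtain U where "open U" "f x \<in> U" "g x \<notin> U"
    using separation_t1 by metis
  then show "\<exists>U. open U \<and> f \<in> U \<and> g \<notin> U"
    by (intro exI[of _ "(\<lambda>h. h x) -` U"]) (auto intro: open_evaluation_vimage)
qed

text \<open>Used at type \<open>'a \<Rightarrow> complex\<close>: compact sets of characters are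
  then closed, and Stone-Weierstrass applies to functions on them.\<close>

instance "fun" :: (type, t2_space) t2_space
proof
  fix f g :: "'a \<Rightarrow> 'b"
  assume "f \<noteq> g"
  then obtain x where "f x \<noteq> g x" by blast
  then obtain U V where "open U" "open V" "f x \<in> U" "g x \<in> V" "U \<inter> V = {}"
    using hausdorff by metis
  then show "\<exists>U V. open U \<and> open V \<and> f \<in> U \<and> g \<in> V \<and> U \<inter> V = {}"
    by (intro exI[of _ "(\<lambda>h. h x) -` U"] exI[of _ "(\<lambda>h. h x) -` V"])
      (auto intro: open_evaluation_vimage)
qed

section \<open>Continuous C*-seminorms\<close>

locale commutative_pro_cstar_algebra = pro_cstar_algebra scaleC star
  for scaleC :: "complex \<Rightarrow> 'a \<Rightarrow>
      'a :: {comm_ring, comm_monoid_mult, t2_space, topological_semigroup_mult,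
             uniform_topological_group_add}"
    and star :: "'a \<Rightarrow> 'a"
begin

sublocale commutative_algebra scaleC
  by unfold_locales (rule scale_mult_left)

definition cont_cstar_seminorm :: "('a \<Rightarrow> real) \<Rightarrow> bool" where
  "cont_cstar_seminorm p \<longleftrightarrow> cstar_seminorm scaleC star p \<and> continuous_on UNIV p"

lemma cstar_seminorm_star_mult: "cont_cstar_seminorm p \<Longrightarrow> p (star x * x) = (p x)\<^sup>2"
  by (simp add: cont_cstar_seminorm_def cstar_seminorm_def)

text \<open>The C*-identity for the self-adjoint element \<open>star x * x\<close> yields
  \<open>(p x) ^ 4\<close>; by commutativity the same product is
  \<open>star (x * x) * (x * x)\<close>, with value \<open>(p (x * x))\<^sup>2\<close>.\<close>

lemma uniform_seminorm_cstar:
  assumes p: "cont_cstar_seminorm p"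
  shows "uniform_seminorm p"
proof -
  have nonneg: "0 \<le> p x" for x
    using p by (simp add: cont_cstar_seminorm_def cstar_seminorm_def)
  have "(p x)\<^sup>2 = p (x * x)" for x
  proof (rule power2_eq_imp_eq)
    have "((p x)\<^sup>2)\<^sup>2 = p (star (star x * x) * (star x * x))"
      by (simp add: cstar_seminorm_star_mult[OF p])
    also have "star (star x * x) * (star x * x) = star (x * x) * (x * x)"
      by (simp add: star_mult star_star ac_simps)
    also have "p \<dots> = (p (x * x))\<^sup>2"
      by (rule cstar_seminorm_star_mult[OF p])
    finally show "((p x)\<^sup>2)\<^sup>2 = (p (x * x))\<^sup>2" .
  qed (use nonneg in auto)
  then show ?thesis
    using p by (simp add: uniform_seminorm_def cont_cstar_seminorm_def cstar_seminorm_def)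
qed

lemmas cseminorm_nonneg = useminorm_nonneg[OF uniform_seminorm_cstar]
  and cseminorm_add = useminorm_add[OF uniform_seminorm_cstar]
  and cseminorm_scale = useminorm_scale[OF uniform_seminorm_cstar]
  and cseminorm_mult = useminorm_mult[OF uniform_seminorm_cstar]
  and cseminorm_zero = useminorm_zero[OF uniform_seminorm_cstar]

lemma cont_cstar_seminorm_zero: "cont_cstar_seminorm (\<lambda>_. 0)"
  by (simp add: cont_cstar_seminorm_def cstar_seminorm_def)

text \<open>Makes the seminorms directed, so that single balls form a neighborhood basis and
  approximation conditions on two spectra combine into one.\<close>

lemma cont_cstar_seminorm_max:
  assumes p: "cont_cstar_seminorm p" and q: "cont_cstar_seminorm q"
  shows "cont_cstar_seminorm (\<lambda>x. max (p x) (q x))"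
  unfolding cont_cstar_seminorm_def cstar_seminorm_def
proof (intro conjI allI)
  fix x y c
  note nonneg = cseminorm_nonneg[OF p] cseminorm_nonneg[OF q]
  show "0 \<le> max (p x) (q x)"
    using nonneg by (simp add: max_def)
  show "max (p (x + y)) (q (x + y)) \<le> max (p x) (q x) + max (p y) (q y)"
    using cseminorm_add[OF p, of x y] cseminorm_add[OF q, of x y] by linarith
  show "max (p (scaleC c x)) (q (scaleC c x)) = cmod c * max (p x) (q x)"
    by (simp add: cseminorm_scale[OF p] cseminorm_scale[OF q] max_mult_distrib_left)
  show "max (p (x * y)) (q (x * y)) \<le> max (p x) (q x) * max (p y) (q y)"
    using nonneg
    by (intro max.boundedI order_trans[OF cseminorm_mult[OF p]] order_trans[OF cseminorm_mult[OF q]]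
        mult_mono) (auto simp: le_max_iff_disj)
  show "max (p (star x * x)) (q (star x * x)) = (max (p x) (q x))\<^sup>2"
    using nonneg by (simp add: cstar_seminorm_star_mult[OF p] cstar_seminorm_star_mult[OF q] max_def)
next
  show "continuous_on UNIV (\<lambda>x. max (p x) (q x))"
    using p q by (auto simp: cont_cstar_seminorm_def intro!: continuous_intros)
qed

lemma open_seminorm_ball:
  assumes "cont_cstar_seminorm p"
  shows "open {b. p (b - a) < e}"
  unfolding topology_generated_by_cstar_seminorms
  using assms by (intro generate_topology.Basis) (auto simp: cont_cstar_seminorm_def)

text \<open>The generating balls have arbitrary centres. The triangle inequality recentres them at
  \<open>a\<close>, and maxima of seminorms absorb finite intersections.\<close>

lemma seminorm_ball_basis:
  assumes "open U" "a \<in> U"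
  obtains p e where "cont_cstar_seminorm p" "0 < e" "\<And>b. p (b - a) < e \<Longrightarrow> b \<in> U"
proof -
  have "generate_topology
      {{b. p (b - a) < e} | p a e. cstar_seminorm scaleC star p \<and> continuous_on UNIV p} U"
    using assms(1) unfolding topology_generated_by_cstar_seminorms .
  then have "\<exists>p e. cont_cstar_seminorm p \<and> 0 < e \<and> (\<forall>b. p (b - a) < e \<longrightarrow> b \<in> U)"
    using assms(2)
  proof (induction arbitrary: a)
    case UNIV
    then show ?case
      using cont_cstar_seminorm_zero zero_less_one by blast
  next
    case (Int U V)
    obtain p d where "cont_cstar_seminorm p" "0 < d" "\<forall>b. p (b - a) < d \<longrightarrow> b \<in> U"
      using Int.IH(1)[of a] Int.prems by blast
    moreover obtain q e where "cont_cstar_seminorm q" "0 < e" "\<forall>b. q (b - a) < e \<longrightarrow> b \<in> V"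
      using Int.IH(2)[of a] Int.prems by blast
    ultimately show ?case
      by (intro exI[of _ "\<lambda>x. max (p x) (q x)"] exI[of _ "min d e"])
        (simp add: cont_cstar_seminorm_max)
  next
    case (UN \<U>)
    then obtain U where "U \<in> \<U>" "a \<in> U" by blast
    with UN.IH[of U a] show ?case by blast
  next
    case (Basis U)
    then obtain p a' e where U: "U = {b. p (b - a') < e}" and p: "cont_cstar_seminorm p"
      by (auto simp: cont_cstar_seminorm_def)
    have "p (b - a') < e" if "p (b - a) < e - p (a - a')" for b
      using cseminorm_add[OF p, of "b - a" "a - a'"] that by simp
    then show ?case
      using Basis(2) p unfolding U by (intro exI[of _ p] exI[of _ "e - p (a - a')"]) auto
  qed
  then show thesis
    using that by blast
qed

lemma eq_zero_if_seminorms_zero: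
  assumes "\<And>p. cont_cstar_seminorm p \<Longrightarrow> p a = 0"
  shows "a = 0"
proof (rule ccontr)
  assume "a \<noteq> 0"
  then obtain p e where "cont_cstar_seminorm p" "0 < e" "\<And>b. p (b - 0) < e \<Longrightarrow> b \<in> - {a}"
    using seminorm_ball_basis[of "- {a}" 0] by auto
  then show False
    using assms by force
qed

section \<open>The spectrum of a seminorm\<close>

text \<open>The Gelfand spectrum of the C*-algebra obtained by completing the quotient by the kernel
  of \<open>p\<close>; empty for \<open>p = 0\<close>, since characters are 1 at the unit.\<close>

definition spectrum :: "('a \<Rightarrow> real) \<Rightarrow> ('a \<Rightarrow> complex) set" where
  "spectrum p = {\<omega>. character \<omega> \<and> (\<forall>x. cmod (\<omega> x) \<le> p x)}"

lemma spectrum_mono: "(\<And>x. p x \<le> q x) \<Longrightarrow> spectrum p \<subseteq> spectrum q"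
  by (auto simp: spectrum_def intro: order_trans)

context
  fixes \<omega> assumes \<omega>: "character \<omega>"
begin

lemma character_one: "\<omega> 1 = 1"
  and character_add: "\<omega> (x + y) = \<omega> x + \<omega> y"
  and character_scale: "\<omega> (scaleC c x) = c * \<omega> x"
  and character_mult: "\<omega> (x * y) = \<omega> x * \<omega> y"
  using \<omega> by (simp_all add: character_def)

lemma character_diff: "\<omega> (x - y) = \<omega> x - \<omega> y"
  using character_add[of "x - y" y] by simp

lemma character_power: "\<omega> (x ^ n) = \<omega> x ^ n"
  by (induction n) (simp_all add: character_one character_mult)

end

lemma seminorm_le_if_characters_le:
  assumes "cont_cstar_seminorm p" "0 \<le> c" "\<And>\<omega>. \<omega> \<in> spectrum p \<Longrightarrow> cmod (\<omega> a) \<le> c"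
  shows "p a \<le> c"
proof (cases "p a = 0")
  case False
  then obtain \<omega> where "character \<omega>" "\<And>x. cmod (\<omega> x) \<le> p x" "cmod (\<omega> a) = p a"
    using character_attains_seminorm[OF uniform_seminorm_cstar[OF assms(1)]] by blast
  then show ?thesis
    using assms(3)[of \<omega>] by (simp add: spectrum_def)
qed (use assms in simp)

lemma star_one: "star 1 = 1"
  by (metis mult_1_left mult_1_right star_mult star_star)

text \<open>Arens: the \<open>C\<^sup>*\<close>-identity bounds \<open>\<bar>\<omega> (h + i t)\<bar>\<^sup>2\<close> by \<open>C + t\<^sup>2\<close> for all real \<open>t\<close>, which
  forces \<open>Im (\<omega> h) = 0\<close>.\<close>

lemma character_self_adjoint_real:
  assumes p: "cont_cstar_seminorm p" and \<omega>: "\<omega> \<in> spectrum p" and h: "star h = h"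
  shows "Im (\<omega> h) = 0"
proof (rule ccontr)
  define \<beta> where "\<beta> = Im (\<omega> h)"
  assume "Im (\<omega> h) \<noteq> 0"
  then have \<beta>: "\<beta> \<noteq> 0" by (simp add: \<beta>_def)
  have char: "character \<omega>" and bound: "\<And>x. cmod (\<omega> x) \<le> p x"
    using \<omega> by (auto simp: spectrum_def)
  have "p 1 = (p 1)\<^sup>2"
    using cstar_seminorm_star_mult[OF p, of 1] by (simp add: star_one)
  then have p1: "p 1 \<le> 1"
    by (auto simp: power2_eq_square)
  have ineq: "2 * \<beta> * t \<le> p (h * h)" for t :: real
  proof -
    define w where "w = scaleC (\<i> * t) 1"
    define z where "z = h + w"
    have "star z = h - w"
      by (simp add: z_def w_def star_add star_scale star_one h)
    then have "star z * z = (h - w) * (h + w)"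
      by (simp only: z_def)
    also have "\<dots> = h * h - w * w"
      by (simp add: algebra_simps)
    also have "w * w = scaleC ((\<i> * t) * (\<i> * t)) 1"
      by (simp add: w_def scale_mult[symmetric] scale_mult'[symmetric])
    also have "(\<i> * t) * (\<i> * t) = - of_real (t\<^sup>2)"
      by (simp add: power2_eq_square algebra_simps)
    finally have star_z: "star z * z = h * h + scaleC (of_real (t\<^sup>2)) 1"
      by simp
    have "(cmod (\<omega> z))\<^sup>2 \<le> (p z)\<^sup>2"
      using bound by (intro power_mono) auto
    also have "\<dots> = p (h * h + scaleC (of_real (t\<^sup>2)) 1)"
      using cstar_seminorm_star_mult[OF p, of z] by (simp only: star_z)
    also have "\<dots> \<le> p (h * h) + t\<^sup>2 * p 1"
      using cseminorm_add[OF p, of "h * h" "scaleC (of_real (t\<^sup>2)) 1"]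
      by (simp only: cseminorm_scale[OF p]) (simp add: norm_power)
    also have "\<dots> \<le> p (h * h) + t\<^sup>2"
      using mult_left_mono[OF p1, of "t\<^sup>2"] by simp
    finally have "(cmod (\<omega> z))\<^sup>2 \<le> p (h * h) + t\<^sup>2" .
    moreover have "(cmod (\<omega> z))\<^sup>2 = (Re (\<omega> h))\<^sup>2 + (\<beta> + t)\<^sup>2"
      by (simp add: z_def w_def character_add[OF char] character_scale[OF char] character_one[OF char]
          cmod_power2 \<beta>_def)
    ultimately have "(Re (\<omega> h))\<^sup>2 + \<beta>\<^sup>2 + 2 * \<beta> * t \<le> p (h * h)"
      by (simp add: power2_sum)
    then show ?thesis
      using zero_le_power2[of "Re (\<omega> h)"] zero_le_power2[of \<beta>] by linarith
  qed
  \<comment> \<open>The parameter solves \<open>2 * \<beta> * t = p (h * h) + 1\<close>.\<close>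
  have "p (h * h) + 1 \<le> p (h * h)"
    using ineq[of "(p (h * h) + 1) / (2 * \<beta>)"] \<beta> by simp
  then show False by simp
qed

text \<open>Both \<open>x + star x\<close> and \<open>scaleC \<i> (x - star x)\<close> are
  self-adjoint; that their values are real gives the imaginary and the real part of the
  claim.\<close>

lemma character_star:
  assumes p: "cont_cstar_seminorm p" and \<omega>: "\<omega> \<in> spectrum p"
  shows "\<omega> (star x) = cnj (\<omega> x)"
proof -
  have char: "character \<omega>"
    using \<omega> by (simp add: spectrum_def)
  have star_diff: "star (x - star x) = star x - x"
    using star_add[of "x - star x" "star x"] by (simp add: star_star algebra_simps)
  have "Im (\<omega> (x + star x)) = 0"
    by (rule character_self_adjoint_real[OF p \<omega>]) (simp add: star_add star_star add.commute)
  moreover have "star (scaleC \<i> (x - star x)) = scaleC \<i> (x - star x)"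
    unfolding star_scale star_diff by (simp add: scale_right_diff_distrib)
  then have "Im (\<omega> (scaleC \<i> (x - star x))) = 0"
    by (rule character_self_adjoint_real[OF p \<omega>])
  ultimately show ?thesis
    by (simp add: character_add[OF char] character_scale[OF char] character_diff[OF char] complex_eq_iff)
qed

text \<open>Tychonoff: a product of discs is compact, and the laws of a character are closed
  conditions for pointwise convergence.\<close>

lemma compact_spectrum: "compact (spectrum p)"
proof -
  have "compactin (product_topology (\<lambda>_ :: 'a. euclidean) UNIV) (PiE UNIV (\<lambda>x. cball (0 :: complex) (p x)))"
    by (simp add: compactin_PiE)
  then have "compact (PiE UNIV (\<lambda>x. cball (0 :: complex) (p x)))"
    by (simp add: euclidean_product_topology)
  moreover have "closed (Collect character)"
    unfolding character_def
    by (intro closed_Collect_conj closed_Collect_all closed_Collect_eq continuous_intros) auto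
  moreover have "spectrum p = PiE UNIV (\<lambda>x. cball 0 (p x)) \<inter> Collect character"
    by (auto simp: spectrum_def PiE_def Pi_def)
  ultimately show ?thesis
    by (simp add: compact_Int_closed)
qed

text \<open>A character is bounded by \<open>p\<close> as soon as it is bounded on some \<open>p\<close>-ball: apply the bound to
  powers.\<close>

lemma spectrumI_bounded_on_ball:
  assumes p: "cont_cstar_seminorm p" and \<omega>: "character \<omega>" and "0 < e"
    and bounded: "\<And>a. p a < e \<Longrightarrow> cmod (\<omega> a) \<le> 1"
  shows "\<omega> \<in> spectrum p"
proof (rule ccontr)
  assume "\<omega> \<notin> spectrum p"
  then obtain a where "p a < cmod (\<omega> a)"
    using \<omega> by (auto simp: spectrum_def not_le)
  then obtain s where s: "p a < s" "s < cmod (\<omega> a)"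
    using dense by blast
  then have s_pos: "0 < s"
    using cseminorm_nonneg[OF p, of a] by linarith
  define b where "b = scaleC (of_real (1 / s)) a"
  have pb: "p b < 1"
    using s s_pos by (simp add: b_def cseminorm_scale[OF p] norm_divide)
  have \<omega>b: "1 < cmod (\<omega> b)"
    using s s_pos by (simp add: b_def character_scale[OF \<omega>] norm_mult norm_divide)
  \<comment> \<open>Exponents start at 1, because \<open>p 1\<close> may equal 1.\<close>
  have p_power: "p (b ^ Suc n) < 1" for n
  proof (induction n)
    case (Suc n)
    have "p (b ^ Suc (Suc n)) \<le> p b * p (b ^ Suc n)"
      using cseminorm_mult[OF p, of b "b ^ Suc n"] by simp
    also have "\<dots> \<le> p b * 1"
      using Suc cseminorm_nonneg[OF p] by (intro mult_left_mono) auto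
    finally show ?case
      using pb by simp
  qed (use pb in simp)
  have "cmod (\<omega> b) ^ Suc n * (e / 2) \<le> 1" for n
  proof -
    define d where "d = scaleC (of_real (e / 2)) (b ^ Suc n)"
    have "p d = e / 2 * p (b ^ Suc n)"
      using \<open>0 < e\<close> by (simp only: d_def cseminorm_scale[OF p] norm_of_real)
    also have "\<dots> < e"
      using mult_strict_left_mono[OF p_power[of n], of "e / 2"] \<open>0 < e\<close> by simp
    finally have "cmod (\<omega> d) \<le> 1"
      by (rule bounded)
    moreover have "cmod (\<omega> d) = e / 2 * cmod (\<omega> b) ^ Suc n"
      using \<open>0 < e\<close>
      by (simp only: d_def character_scale[OF \<omega>] character_power[OF \<omega>] norm_mult norm_of_real norm_power)
    ultimately show ?thesis
      by (simp only: mult.commute)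
  qed
  then have le: "cmod (\<omega> b) ^ Suc n \<le> 2 / e" for n
    using \<open>0 < e\<close> by (simp add: pos_le_divide_eq)
  obtain n where "2 / e < cmod (\<omega> b) ^ n"
    using real_arch_pow[OF \<omega>b] by blast
  moreover have "cmod (\<omega> b) ^ n \<le> cmod (\<omega> b) ^ Suc n"
    using \<omega>b by (intro power_increasing) auto
  ultimately show False
    using le[of n] by linarith
qed

text \<open>Real Stone-Weierstrass, applied to \<open>Re (f \<omega>)\<close> and
  \<open>Im (f \<omega>)\<close> with error \<open>e / 2\<close> each. As
  \<open>\<omega> (star a) = cnj (\<omega> a)\<close>, the real and imaginary parts of evaluations
  are themselves evaluations on the spectrum, and they separate points.\<close>

lemma spectrum_dense_image:
  assumes p: "cont_cstar_seminorm p" and f: "continuous_on (spectrum p) f" and "0 < e"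
  shows "\<exists>a. \<forall>\<omega>\<in>spectrum p. cmod (\<omega> a - f \<omega>) \<le> e"
proof -
  define R where "R = {g. continuous_on (spectrum p) g \<and>
    (\<exists>a. \<forall>\<omega>\<in>spectrum p. \<omega> a = complex_of_real (g \<omega>))}"
  have char: "character \<omega>" if "\<omega> \<in> spectrum p" for \<omega>
    using that by (simp add: spectrum_def)
  have eval_cont: "continuous_on (spectrum p) (\<lambda>\<omega>. \<omega> a)" for a
    by (rule continuous_on_subset[OF continuous_on_product_coordinates]) simp
  have Re_R: "(\<lambda>\<omega>. Re (\<omega> a)) \<in> R" for a
    unfolding R_def using eval_cont
    by (auto intro!: continuous_intros exI[of _ "scaleC (1/2) (a + star a)"]
        simp: character_scale[OF char] character_add[OF char] character_star[OF p] complex_eq_iff)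
  \<comment> \<open>For \<open>z = \<omega> a\<close>, the number
    \<open>\<i> / 2 * (cnj z - z)\<close> is \<open>Im z\<close>.\<close>
  have Im_R: "(\<lambda>\<omega>. Im (\<omega> a)) \<in> R" for a
    unfolding R_def using eval_cont
    by (auto intro!: continuous_intros exI[of _ "scaleC (\<i> / 2) (star a - a)"]
        simp: character_scale[OF char] character_diff[OF char] character_star[OF p] complex_eq_iff)
  interpret function_ring_on R "spectrum p"
  proof
    show "compact (spectrum p)"
      by (rule compact_spectrum)
    show "continuous_on (spectrum p) g" if "g \<in> R" for g
      using that by (simp add: R_def)
    show "(\<lambda>\<omega>. g \<omega> + h \<omega>) \<in> R" if "g \<in> R" "h \<in> R" for g h
      using that unfolding R_def
      by (auto intro!: continuous_intros) (metis character_add char)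
    show "(\<lambda>\<omega>. g \<omega> * h \<omega>) \<in> R" if "g \<in> R" "h \<in> R" for g h
      using that unfolding R_def
      by (auto intro!: continuous_intros) (metis character_mult char)
    show "(\<lambda>_. c) \<in> R" for c
      unfolding R_def
      by (auto intro!: exI[of _ "scaleC (of_real c) 1"] simp: character_scale[OF char] character_one[OF char])
    fix \<omega> \<psi> :: "'a \<Rightarrow> complex" assume "\<omega> \<noteq> \<psi>"
    then obtain a where "\<omega> a \<noteq> \<psi> a" by blast
    then have "Re (\<omega> a) \<noteq> Re (\<psi> a) \<or> Im (\<omega> a) \<noteq> Im (\<psi> a)"
      by (auto simp: complex_eq_iff)
    then show "\<exists>g\<in>R. g \<omega> \<noteq> g \<psi>"
    proof
      assume "Re (\<omega> a) \<noteq> Re (\<psi> a)"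
      then show ?thesis by (rule bexI[OF _ Re_R])
    next
      assume "Im (\<omega> a) \<noteq> Im (\<psi> a)"
      then show ?thesis by (rule bexI[OF _ Im_R])
    qed
  qed
  have real_approx: "\<exists>a. \<forall>\<omega>\<in>spectrum p. cmod (\<omega> a - of_real (g \<omega>)) \<le> e / 2"
    if g: "continuous_on (spectrum p) g" for g
  proof -
    obtain h where h: "h \<in> R" "\<And>\<omega>. \<omega> \<in> spectrum p \<Longrightarrow> \<bar>g \<omega> - h \<omega>\<bar> < e / 2"
      using Stone_Weierstrass_basic[OF g, of "e / 2"] \<open>0 < e\<close> by auto
    then obtain a where a: "\<And>\<omega>. \<omega> \<in> spectrum p \<Longrightarrow> \<omega> a = complex_of_real (h \<omega>)"
      by (auto simp: R_def)
    have "cmod (\<omega> a - of_real (g \<omega>)) \<le> e / 2" if "\<omega> \<in> spectrum p" for \<omega>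
      using h(2)[OF that] unfolding a[OF that] of_real_diff[symmetric] norm_of_real by linarith
    then show ?thesis by blast
  qed
  obtain a where a: "\<And>\<omega>. \<omega> \<in> spectrum p \<Longrightarrow> cmod (\<omega> a - of_real (Re (f \<omega>))) \<le> e / 2"
    using real_approx[of "\<lambda>\<omega>. Re (f \<omega>)"] f by (auto intro!: continuous_intros)
  obtain b where b: "\<And>\<omega>. \<omega> \<in> spectrum p \<Longrightarrow> cmod (\<omega> b - of_real (Im (f \<omega>))) \<le> e / 2"
    using real_approx[of "\<lambda>\<omega>. Im (f \<omega>)"] f by (auto intro!: continuous_intros)
  have "cmod (\<omega> (a + scaleC \<i> b) - f \<omega>) \<le> e" if \<omega>: "\<omega> \<in> spectrum p" for \<omega>
  proof -
    have "\<omega> (a + scaleC \<i> b) - f \<omega>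
        = (\<omega> a - of_real (Re (f \<omega>))) + \<i> * (\<omega> b - of_real (Im (f \<omega>)))"
      using char[OF \<omega>] complex_eq[of "f \<omega>"]
      by (simp add: character_add character_scale algebra_simps)
    then have "cmod (\<omega> (a + scaleC \<i> b) - f \<omega>)
        \<le> cmod (\<omega> a - of_real (Re (f \<omega>))) + cmod (\<omega> b - of_real (Im (f \<omega>)))"
      using norm_triangle_ineq[of "\<omega> a - of_real (Re (f \<omega>))" "\<i> * (\<omega> b - of_real (Im (f \<omega>)))"]
      by (simp add: norm_mult)
    then show ?thesis
      using a[OF \<omega>] b[OF \<omega>] by linarith
  qed
  then show ?thesis by blast
qed

section \<open>The space of continuous characters\<close>

text \<open>These are exactly the continuous characters: continuity bounds a character on a ball of
  some \<open>p\<close>, and \<open>spectrumI_bounded_on_ball\<close> turns this into a bound by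
  \<open>p\<close>.\<close>

definition spectra :: "('a \<Rightarrow> complex) set" where
  "spectra = (\<Union>p \<in> Collect cont_cstar_seminorm. spectrum p)"

text \<open>The characters carry the colimit topology of the compact sets \<open>spectrum p\<close>, which is finer
  than the topology of pointwise convergence; only for it does completeness of the algebra make
  every continuous function an evaluation.\<close>

definition spectral_topology :: "('a \<Rightarrow> complex) topology" where
  "spectral_topology = topology (\<lambda>U. U \<subseteq> spectra \<and>
     (\<forall>p. cont_cstar_seminorm p \<longrightarrow> openin (top_of_set (spectrum p)) (U \<inter> spectrum p)))"

lemma spectrum_subset: "cont_cstar_seminorm p \<Longrightarrow> spectrum p \<subseteq> spectra"
  by (auto simp: spectra_def)

lemma openin_spectral:
  "openin spectral_topology U \<longleftrightarrow> U \<subseteq> spectra \<and>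
     (\<forall>p. cont_cstar_seminorm p \<longrightarrow> openin (top_of_set (spectrum p)) (U \<inter> spectrum p))"
proof -
  have "istopology (\<lambda>U. U \<subseteq> spectra \<and>
     (\<forall>p. cont_cstar_seminorm p \<longrightarrow> openin (top_of_set (spectrum p)) (U \<inter> spectrum p)))"
    unfolding istopology_def
  proof (intro conjI allI impI; (elim conjE)?)
    fix U V p
    assume "\<forall>p. cont_cstar_seminorm p \<longrightarrow> openin (top_of_set (spectrum p)) (U \<inter> spectrum p)"
      "\<forall>p. cont_cstar_seminorm p \<longrightarrow> openin (top_of_set (spectrum p)) (V \<inter> spectrum p)"
      "cont_cstar_seminorm p"
    then have "openin (top_of_set (spectrum p)) ((U \<inter> spectrum p) \<inter> (V \<inter> spectrum p))"
      by blast
    moreover have "(U \<inter> spectrum p) \<inter> (V \<inter> spectrum p) = U \<inter> V \<inter> spectrum p"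
      by blast
    ultimately show "openin (top_of_set (spectrum p)) (U \<inter> V \<inter> spectrum p)"
      by (simp only:)
  next
    fix \<U> p
    assume \<U>: "\<forall>U\<in>\<U>. U \<subseteq> spectra \<and>
      (\<forall>p. cont_cstar_seminorm p \<longrightarrow> openin (top_of_set (spectrum p)) (U \<inter> spectrum p))"
    then show "\<Union> \<U> \<subseteq> spectra" by blast
    assume "cont_cstar_seminorm p"
    with \<U> have "openin (top_of_set (spectrum p)) (\<Union>U\<in>\<U>. U \<inter> spectrum p)"
      by (intro openin_Union) auto
    then show "openin (top_of_set (spectrum p)) (\<Union> \<U> \<inter> spectrum p)"
      by (simp add: Int_commute Int_Union)
  qed auto
  then show ?thesis
    unfolding spectral_topology_def by simp
qed

lemma openin_spectral_open: "open U \<Longrightarrow> openin spectral_topology (U \<inter> spectra)"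
  using spectrum_subset by (auto simp: openin_spectral openin_open Int_assoc Int_absorb1 Int_commute)

lemma topspace_spectral [simp]: "topspace spectral_topology = spectra"
proof
  show "topspace spectral_topology \<subseteq> spectra"
    using openin_topspace[of spectral_topology] unfolding openin_spectral by (rule conjunct1)
  show "spectra \<subseteq> topspace spectral_topology"
    using openin_subset[OF openin_spectral_open[of UNIV]] by simp
qed

lemma continuous_map_evaluation: "continuous_map spectral_topology euclidean (\<lambda>\<omega>. \<omega> a)"
  unfolding continuous_map_def
proof (intro conjI allI impI)
  fix V :: "complex set" assume "openin euclidean V"
  then have "open ((\<lambda>\<omega> :: 'a \<Rightarrow> complex. \<omega> a) -` V)"
    by (intro open_vimage) auto
  from openin_spectral_open[OF this]
  show "openin spectral_topology {\<omega> \<in> topspace spectral_topology. \<omega> a \<in> V}"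
    by (simp add: vimage_def Int_def conj_commute)
qed simp

lemma continuous_map_inclusion_spectrum:
  assumes "cont_cstar_seminorm p"
  shows "continuous_map (top_of_set (spectrum p)) spectral_topology id"
  unfolding continuous_map_def
proof (intro conjI allI impI)
  fix U assume "openin spectral_topology U"
  then show "openin (top_of_set (spectrum p)) {\<omega> \<in> topspace (top_of_set (spectrum p)). id \<omega> \<in> U}"
    using assms by (simp add: openin_spectral Int_def conj_commute)
qed (use spectrum_subset[OF assms] in auto)

lemma compactin_spectrum: "cont_cstar_seminorm p \<Longrightarrow> compactin spectral_topology (spectrum p)"
  using image_compactin[OF _ continuous_map_inclusion_spectrum, of p "spectrum p"]
  by (simp add: compactin_subtopology compact_spectrum)

lemma closedin_spectrum:
  assumes "cont_cstar_seminorm p"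
  shows "closedin spectral_topology (spectrum p)"
proof -
  have "open (- spectrum p)"
    by (intro open_Compl compact_imp_closed compact_spectrum)
  from openin_spectral_open[OF this] show ?thesis
    using spectrum_subset[OF assms] by (simp add: closedin_def Diff_eq Int_commute)
qed

lemma continuous_on_spectrum:
  assumes "cont_cstar_seminorm p" "continuous_map spectral_topology euclidean f"
  shows "continuous_on (spectrum p) f"
  using continuous_map_compose[OF continuous_map_inclusion_spectrum[OF assms(1)] assms(2)] by simp

lemma functionally_Hausdorff_spectral: "functionally_Hausdorff spectral_topology"
  unfolding functionally_Hausdorff_def
proof (intro ballI impI)
  fix \<omega> \<psi> :: "'a \<Rightarrow> complex"
  assume "\<omega> \<noteq> \<psi>"
  then obtain a where "\<omega> a \<noteq> \<psi> a" by blast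
  then have "Re (\<omega> a) \<noteq> Re (\<psi> a) \<or> Im (\<omega> a) \<noteq> Im (\<psi> a)"
    by (auto simp: complex_eq_iff)
  moreover have "continuous_map spectral_topology euclideanreal (\<lambda>\<omega>. Re (\<omega> a))"
    "continuous_map spectral_topology euclideanreal (\<lambda>\<omega>. Im (\<omega> a))"
    using continuous_map_evaluation[of a]
    by (auto simp: continuous_map_euclidean_iff_tendsto intro!: tendsto_intros)
  ultimately show "\<exists>f. continuous_map spectral_topology euclideanreal f \<and> f \<omega> \<noteq> f \<psi>"
    by blast
qed

text \<open>The sets of elements approximating \<open>f\<close> within \<open>e\<close> on
  \<open>spectrum p\<close> form a filter base, nonempty by \<open>spectrum_dense_image\<close>. Two
  elements within \<open>e / 3\<close> of \<open>f\<close> have \<open>p\<close>-distance below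
  \<open>e\<close>, so the filter is Cauchy; evaluation at its limit is \<open>f\<close>.\<close>

lemma continuous_function_is_evaluation:
  assumes f: "continuous_map spectral_topology euclidean f"
  obtains a where "\<And>\<omega>. \<omega> \<in> spectra \<Longrightarrow> \<omega> a = f \<omega>"
proof -
  define I :: "(('a \<Rightarrow> real) \<times> real) set" where "I = {(p, e). cont_cstar_seminorm p \<and> 0 < e}"
  define P where "P = (\<lambda>(p, e). {a. \<forall>\<omega>\<in>spectrum p. cmod (\<omega> a - f \<omega>) \<le> e})"
  define F where "F = (INF i\<in>I. principal (P i))"
  have eventually_F: "eventually Q F \<longleftrightarrow> (\<exists>i\<in>I. \<forall>a\<in>P i. Q a)" for Q
    unfolding F_def
  proof (subst eventually_INF_base)
    show "I \<noteq> {}"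
      using cont_cstar_seminorm_zero by (auto simp: I_def intro: exI[of _ 1])
    fix i j assume ij: "i \<in> I" "j \<in> I"
    obtain p d q e where i: "i = (p, d)" and j: "j = (q, e)"
      by (cases i, cases j)
    define r where "r = (\<lambda>x. max (p x) (q x))"
    have "spectrum p \<subseteq> spectrum r" "spectrum q \<subseteq> spectrum r"
      unfolding r_def by (intro spectrum_mono; simp)+
    then have "P (r, min d e) \<subseteq> P i \<inter> P j"
      unfolding P_def i j by fastforce
    moreover have "(r, min d e) \<in> I"
      using ij by (simp add: I_def i j r_def cont_cstar_seminorm_max)
    ultimately show "\<exists>k\<in>I. principal (P k) \<le> inf (principal (P i)) (principal (P j))"
      by (auto intro!: bexI[of _ "(r, min d e)"])
  qed (simp add: eventually_principal)
  have "F \<noteq> bot"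
    unfolding trivial_limit_def eventually_F
    using spectrum_dense_image continuous_on_spectrum[OF _ f] by (auto simp: I_def P_def)
  moreover have "cauchy_filter F"
    unfolding cauchy_filter_def le_filter_def
  proof (intro allI impI)
    fix E :: "'a \<times> 'a \<Rightarrow> bool" assume "eventually E uniformity"
    then obtain Q where "eventually Q (nhds 0)" and Q: "\<And>x y. Q (y - x) \<Longrightarrow> E (x, y)"
      unfolding uniformity_eq_translations_nhds_0 by (auto simp: eventually_filtercomap)
    then obtain U where "open U" "0 \<in> U" and U: "\<And>x. x \<in> U \<Longrightarrow> Q x"
      by (auto simp: eventually_nhds)
    then obtain p e where p: "cont_cstar_seminorm p" and e: "0 < e"
      and pe: "\<And>b. p (b - 0) < e \<Longrightarrow> b \<in> U"
      using seminorm_ball_basis by metis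
    have "E (x, y)" if xy: "x \<in> P (p, e / 3)" "y \<in> P (p, e / 3)" for x y
    proof -
      have "p (y - x) \<le> 2 * e / 3"
      proof (rule seminorm_le_if_characters_le[OF p])
        fix \<omega> assume \<omega>: "\<omega> \<in> spectrum p"
        then have "cmod (\<omega> x - f \<omega>) \<le> e / 3" "cmod (\<omega> y - f \<omega>) \<le> e / 3"
          using xy by (auto simp: P_def)
        moreover have "\<omega> (y - x) = (\<omega> y - f \<omega>) - (\<omega> x - f \<omega>)"
          using \<omega> by (simp add: spectrum_def character_diff)
        ultimately show "cmod (\<omega> (y - x)) \<le> 2 * e / 3"
          using norm_triangle_ineq4[of "\<omega> y - f \<omega>" "\<omega> x - f \<omega>"] by simp
      qed (use e in simp)
      then show ?thesis
        using pe[of "y - x"] U Q e by simp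
    qed
    moreover have "eventually (\<lambda>x. x \<in> P (p, e / 3)) F"
      unfolding eventually_F using p e by (intro bexI[of _ "(p, e / 3)"]) (auto simp: I_def)
    ultimately show "eventually E (F \<times>\<^sub>F F)"
      by (auto simp: eventually_prod_same intro!: exI[of _ "\<lambda>x. x \<in> P (p, e / 3)"])
  qed
  ultimately obtain a where a: "F \<le> nhds a"
    using complete_UNIV unfolding complete_uniform by auto
  have "\<omega> a = f \<omega>" if "\<omega> \<in> spectra" for \<omega>
  proof -
    obtain p where p: "cont_cstar_seminorm p" and \<omega>: "\<omega> \<in> spectrum p"
      using \<open>\<omega> \<in> spectra\<close> by (auto simp: spectra_def)
    have "cmod (\<omega> a - f \<omega>) \<le> 0 + e" if e: "0 < e" for e
    proof -
      have "eventually (\<lambda>x. x \<in> P (p, e / 2)) F"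
        unfolding eventually_F using p e by (intro bexI[of _ "(p, e / 2)"]) (auto simp: I_def)
      moreover have "eventually (\<lambda>x. x \<in> {x. p (x - a) < e / 2}) F"
        using e cseminorm_zero[OF p]
        by (intro filter_leD[OF a] eventually_nhds_in_open open_seminorm_ball[OF p]) simp
      ultimately have "eventually (\<lambda>x. x \<in> P (p, e / 2) \<and> p (x - a) < e / 2) F"
        by eventually_elim auto
      then obtain x where x: "x \<in> P (p, e / 2)" "p (x - a) < e / 2"
        using eventually_happens'[OF \<open>F \<noteq> bot\<close>] by blast
      have eq: "\<omega> a - f \<omega> = (\<omega> x - f \<omega>) - \<omega> (x - a)"
        using \<omega> by (simp add: spectrum_def character_diff)
      have "cmod (\<omega> x - f \<omega>) \<le> e / 2"
        using x(1) \<omega> by (auto simp: P_def)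
      moreover have "cmod (\<omega> (x - a)) \<le> p (x - a)"
        using \<omega> by (simp add: spectrum_def)
      ultimately show ?thesis
        unfolding eq using norm_triangle_ineq4[of "\<omega> x - f \<omega>" "\<omega> (x - a)"] x(2) by linarith
    qed
    then have "cmod (\<omega> a - f \<omega>) \<le> 0"
      by (rule field_le_epsilon)
    then show ?thesis by simp
  qed
  then show thesis
    by (rule that)
qed

section \<open>The spectrum of a barreled commutative pro-C*-algebra\<close>

lemma relatively_pseudocompact_subset_spectrum:
  assumes "barreled scaleC" and A: "relatively_pseudocompact_in spectral_topology A"
  obtains p where "cont_cstar_seminorm p" "A \<subseteq> spectrum p"
proof -
  define B where "B = {a. \<forall>\<omega>\<in>A. cmod (\<omega> a) \<le> 1}"
  have A_char: "\<exists>p. cont_cstar_seminorm p \<and> \<omega> \<in> spectrum p" if "\<omega> \<in> A" for \<omega>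
    using A that by (auto simp: relatively_pseudocompact_in_def spectra_def)
  have char: "character \<omega>" if "\<omega> \<in> A" for \<omega>
    using A_char[OF that] by (auto simp: spectrum_def)
  have "absolutely_convex scaleC B"
    unfolding absolutely_convex_def
  proof (intro ballI allI impI)
    fix x y a b assume xy: "x \<in> B" "y \<in> B" and ab: "cmod a + cmod b \<le> 1"
    have "cmod (\<omega> (scaleC a x + scaleC b y)) \<le> 1" if \<omega>: "\<omega> \<in> A" for \<omega>
    proof -
      have "cmod (\<omega> (scaleC a x + scaleC b y)) \<le> cmod a * cmod (\<omega> x) + cmod b * cmod (\<omega> y)"
        using char[OF \<omega>] norm_triangle_ineq[of "a * \<omega> x" "b * \<omega> y"]
        by (simp add: character_add character_scale norm_mult)
      also have "\<dots> \<le> cmod a * 1 + cmod b * 1"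
        using xy \<omega> by (intro add_mono mult_left_mono) (auto simp: B_def)
      finally show ?thesis
        using ab by simp
    qed
    then show "scaleC a x + scaleC b y \<in> B"
      by (simp add: B_def)
  qed
  moreover have "absorbing scaleC B"
    unfolding absorbing_def
  proof
    fix a
    \<comment> \<open>Relative pseudocompactness bounds the evaluation at \<open>a\<close> on
      \<open>A\<close>, which is what absorbing \<open>a\<close> requires.\<close>
    have "continuous_map spectral_topology euclideanreal (\<lambda>\<omega>. cmod (\<omega> a))"
      using continuous_map_evaluation[of a]
      by (auto simp: continuous_map_euclidean_iff_tendsto intro!: tendsto_intros)
    then have "bounded ((\<lambda>\<omega>. cmod (\<omega> a)) ` A)"
      using A by (simp add: relatively_pseudocompact_in_def)
    then obtain M where M: "0 < M" "\<And>\<omega>. \<omega> \<in> A \<Longrightarrow> cmod (\<omega> a) \<le> M"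
      by (auto simp: bounded_pos)
    have "a \<in> scaleC c ` B" if "M \<le> cmod c" for c
    proof
      have c: "c \<noteq> 0"
        using that M by auto
      then show "a = scaleC c (scaleC (1 / c) a)"
        by simp
      show "scaleC (1 / c) a \<in> B"
        using M(2) that c unfolding B_def
        by (auto simp: character_scale[OF char] norm_divide divide_simps intro: order_trans)
    qed
    then show "\<exists>r>0. \<forall>c. r \<le> cmod c \<longrightarrow> a \<in> scaleC c ` B"
      using M(1) by blast
  qed
  moreover have "closed B"
  proof -
    have "closed {a. cmod (\<omega> a) \<le> 1}" if "\<omega> \<in> A" for \<omega>
      unfolding closed_def
    proof (subst open_subopen, intro ballI)
      obtain p where p: "cont_cstar_seminorm p" and \<omega>: "\<omega> \<in> spectrum p"
        using A_char[OF \<open>\<omega> \<in> A\<close>] by blast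
      fix a assume "a \<in> - {a. cmod (\<omega> a) \<le> 1}"
      then have a: "1 < cmod (\<omega> a)" by simp
      have "\<not> cmod (\<omega> b) \<le> 1" if "p (b - a) < cmod (\<omega> a) - 1" for b
      proof -
        have "cmod (\<omega> (b - a)) \<le> p (b - a)"
          using \<omega> by (simp add: spectrum_def)
        then have "cmod (\<omega> b - \<omega> a) < cmod (\<omega> a) - 1"
          using that \<omega> by (simp add: spectrum_def character_diff)
        then show ?thesis
          using norm_triangle_ineq3[of "\<omega> b" "\<omega> a"] by linarith
      qed
      then show "\<exists>T. open T \<and> a \<in> T \<and> T \<subseteq> - {a. cmod (\<omega> a) \<le> 1}"
        using open_seminorm_ball[OF p] a cseminorm_zero[OF p]
        by (intro exI[of _ "{b. p (b - a) < cmod (\<omega> a) - 1}"]) auto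
    qed
    moreover have "B = (\<Inter>\<omega>\<in>A. {a. cmod (\<omega> a) \<le> 1})"
      by (auto simp: B_def)
    ultimately show ?thesis by auto
  qed
  ultimately have "0 \<in> interior B"
    using assms(1) by (simp add: barreled_def barrel_def)
  then obtain p e where p: "cont_cstar_seminorm p" "0 < e" "\<And>b. p (b - 0) < e \<Longrightarrow> b \<in> interior B"
    using seminorm_ball_basis[OF open_interior] by metis
  \<comment> \<open>One ball of \<open>p\<close> inside \<open>B\<close> bounds all characters in
    \<open>A\<close> by 1, so the same \<open>p\<close> dominates each of them.\<close>
  have "\<omega> \<in> spectrum p" if "\<omega> \<in> A" for \<omega>
    using p(3) interior_subset that
    by (intro spectrumI_bounded_on_ball[OF p(1) char p(2)]) (auto simp: B_def subset_iff)
  then show thesis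
    using that p(1) by blast
qed

lemma relatively_compact_spectral:
  assumes "barreled scaleC" and A: "relatively_pseudocompact_in spectral_topology A"
  shows "relatively_compact_in spectral_topology A"
proof -
  obtain p where p: "cont_cstar_seminorm p" "A \<subseteq> spectrum p"
    using relatively_pseudocompact_subset_spectrum[OF assms] by blast
  then have "spectral_topology closure_of A \<subseteq> spectrum p"
    by (intro closure_of_minimal closedin_spectrum)
  then have "compactin spectral_topology (spectral_topology closure_of A)"
    by (rule closed_compactin[OF compactin_spectrum[OF p(1)]]) simp
  then show ?thesis
    using A by (simp add: relatively_compact_in_def relatively_pseudocompact_in_def)
qed

text \<open>Compact sets of characters are relatively pseudocompact and, by barreledness, lie in
  some \<open>spectrum p\<close>; hence evaluation is continuous into the compact-open topology. It
  is open because each \<open>spectrum p\<close> is compact and determines \<open>p\<close>.\<close>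

lemma isomorphic_to_cfun_spectral:
  assumes barreled: "barreled scaleC"
  shows "isomorphic_to_cfun scaleC star spectral_topology"
proof -
  define \<phi> :: "'a \<Rightarrow> ('a \<Rightarrow> complex) \<Rightarrow> complex" where "\<phi> a = (\<lambda>\<omega>\<in>spectra. \<omega> a)" for a
  have \<phi>: "\<phi> a \<omega> = \<omega> a" if "\<omega> \<in> spectra" for a \<omega>
    using that by (simp add: \<phi>_def)
  have char: "character \<omega>" if "\<omega> \<in> spectra" for \<omega>
    using that by (auto simp: spectra_def spectrum_def)
  have star: "\<omega> (star a) = cnj (\<omega> a)" if "\<omega> \<in> spectra" for \<omega> a
    using that character_star by (auto simp: spectra_def)
  have in_cfun: "\<phi> a \<in> cfun spectral_topology" for a
    using continuous_map_eq[OF continuous_map_evaluation[of a], of "\<phi> a"]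
    by (simp add: cfun_def \<phi>_def)
  have surj: "\<phi> ` UNIV = cfun spectral_topology"
  proof
    show "cfun spectral_topology \<subseteq> \<phi> ` UNIV"
    proof
      fix f assume f: "f \<in> cfun spectral_topology"
      then obtain a where "\<And>\<omega>. \<omega> \<in> spectra \<Longrightarrow> \<omega> a = f \<omega>"
        using continuous_function_is_evaluation by (auto simp: cfun_def)
      then have "f = \<phi> a"
        using f by (auto simp: cfun_def \<phi>_def intro: extensionalityI)
      then show "f \<in> \<phi> ` UNIV" by blast
    qed
  qed (use in_cfun in auto)
  have inj: "inj \<phi>"
  proof (rule injI)
    fix a b assume eq: "\<phi> a = \<phi> b"
    have "\<omega> (a - b) = 0" if "\<omega> \<in> spectra" for \<omega>
      using fun_cong[OF eq, of \<omega>] that by (simp add: \<phi> character_diff[OF char])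
    then have "p (a - b) \<le> 0" if "cont_cstar_seminorm p" for p
      using spectrum_subset[OF that] by (intro seminorm_le_if_characters_le[OF that]) auto
    then have "a - b = 0"
      using cseminorm_nonneg by (intro eq_zero_if_seminorms_zero) (simp add: antisym)
    then show "a = b" by simp
  qed
  have "continuous_map euclidean (compact_open spectral_topology) \<phi>"
    unfolding compact_open_def
  proof (rule continuous_on_generated_topo)
    show "\<phi> ` topspace euclidean \<subseteq> \<Union> {{g \<in> cfun spectral_topology. \<forall>x\<in>K. dist (f x) (g x) < e} | f K e.
        f \<in> cfun spectral_topology \<and> compactin spectral_topology K \<and> 0 < e}"
      using surj topspace_compact_open[of spectral_topology]
      unfolding compact_open_def topology_generated_by_topspace by simp
    fix V assume "V \<in> {{g \<in> cfun spectral_topology. \<forall>x\<in>K. dist (f x) (g x) < e} | f K e.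
        f \<in> cfun spectral_topology \<and> compactin spectral_topology K \<and> 0 < e}"
    then have V: "openin (compact_open spectral_topology) V"
      unfolding compact_open_def by (rule topology_generated_by_Basis)
    have "open (\<phi> -` V)"
    proof (subst open_subopen, intro ballI)
      fix a assume "a \<in> \<phi> -` V"
      then obtain K e where K: "compactin spectral_topology K" and e: "0 < e"
        and KV: "\<And>g. g \<in> cfun spectral_topology \<Longrightarrow> (\<And>x. x \<in> K \<Longrightarrow> dist (\<phi> a x) (g x) < e) \<Longrightarrow> g \<in> V"
        using compact_open_basis[OF V] by blast
      have "K \<subseteq> topspace spectral_topology"
        using K by (rule compactin_subset_topspace)
      moreover have "bounded (f ` K)" if "continuous_map spectral_topology euclideanreal f" for f
        using image_compactin[OF K that] by (simp add: compact_imp_bounded)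
      ultimately have "relatively_pseudocompact_in spectral_topology K"
        by (simp add: relatively_pseudocompact_in_def)
      then obtain p where p: "cont_cstar_seminorm p" "K \<subseteq> spectrum p"
        using relatively_pseudocompact_subset_spectrum[OF barreled] by blast
      have "\<phi> b \<in> V" if b: "p (b - a) < e" for b
      proof (rule KV[OF in_cfun])
        fix \<omega> assume "\<omega> \<in> K"
        then have \<omega>: "\<omega> \<in> spectrum p" "\<omega> \<in> spectra"
          using p spectrum_subset by auto
        then have "cmod (\<omega> (b - a)) < e"
          using b by (auto simp: spectrum_def intro: le_less_trans)
        then show "dist (\<phi> a \<omega>) (\<phi> b \<omega>) < e"
          using \<omega>(2) by (simp add: \<phi> dist_norm norm_minus_commute character_diff[OF char])
      qed
      then show "\<exists>T. open T \<and> a \<in> T \<and> T \<subseteq> \<phi> -` V"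
        using open_seminorm_ball[OF p(1)] e cseminorm_zero[OF p(1)]
        by (intro exI[of _ "{b. p (b - a) < e}"]) auto
    qed
    then show "openin euclidean (\<phi> -` V \<inter> topspace euclidean)" by simp
  qed
  moreover have "open_map euclidean (compact_open spectral_topology) \<phi>"
    unfolding open_map_def
  proof (intro allI impI)
    fix U :: "'a set" assume "openin euclidean U"
    then have U: "open U" by simp
    show "openin (compact_open spectral_topology) (\<phi> ` U)"
    proof (subst openin_subopen, intro ballI)
      fix f assume "f \<in> \<phi> ` U"
      then obtain a where f: "f = \<phi> a" and "a \<in> U" by blast
      then obtain p e where p: "cont_cstar_seminorm p" and e: "0 < e"
        and pU: "\<And>b. p (b - a) < e \<Longrightarrow> b \<in> U"
        using seminorm_ball_basis[OF U] by blast
      \<comment> \<open>The bound by characters only yields a weak inequality for \<open>p\<close>;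
        radius \<open>e / 2\<close> keeps it strictly below \<open>e\<close>.\<close>
      define V where "V = {g \<in> cfun spectral_topology. \<forall>\<omega>\<in>spectrum p. dist (\<phi> a \<omega>) (g \<omega>) < e / 2}"
      have "openin (compact_open spectral_topology) V"
        unfolding V_def compact_open_def
        using in_cfun compactin_spectrum[OF p] e half_gt_zero
        by (intro topology_generated_by_Basis) blast
      moreover have "f \<in> V"
        using e in_cfun by (simp add: V_def f)
      moreover have "V \<subseteq> \<phi> ` U"
      proof
        fix g assume g: "g \<in> V"
        then obtain b where b: "g = \<phi> b"
          using surj by (auto simp: V_def)
        have "p (b - a) \<le> e / 2"
        proof (rule seminorm_le_if_characters_le[OF p])
          fix \<omega> assume \<omega>: "\<omega> \<in> spectrum p"
          then have "\<omega> \<in> spectra"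
            using spectrum_subset[OF p] by blast
          moreover have "dist (\<phi> a \<omega>) (\<phi> b \<omega>) < e / 2"
            using g b \<omega> by (simp add: V_def)
          ultimately show "cmod (\<omega> (b - a)) \<le> e / 2"
            by (simp add: \<phi> dist_norm norm_minus_commute character_diff[OF char])
        qed (use e in simp)
        then have "b \<in> U"
          using e by (intro pU) simp
        then show "g \<in> \<phi> ` U"
          using b by blast
      qed
      ultimately show "\<exists>T. openin (compact_open spectral_topology) T \<and> f \<in> T \<and> T \<subseteq> \<phi> ` U"
        by blast
    qed
  qed
  ultimately have "homeomorphic_map euclidean (compact_open spectral_topology) \<phi>"
    using surj inj by (intro bijective_open_imp_homeomorphic_map) auto
  then have "star_algebra_iso_cfun scaleC star spectral_topology \<phi>"
    unfolding star_algebra_iso_cfun_def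
    by (auto simp: \<phi>_def star character_add[OF char] character_scale[OF char] character_mult[OF char]
        intro!: restrict_ext)
  then show ?thesis
    unfolding isomorphic_to_cfun_def by blast
qed

end

theorem proposition3p1:
  fixes scaleC :: "complex \<Rightarrow> 'a \<Rightarrow>
      'a :: {comm_ring, comm_monoid_mult, t2_space, topological_semigroup_mult,
             uniform_topological_group_add}"
    and star :: "'a \<Rightarrow> 'a"
  assumes "pro_cstar_algebra scaleC star"
  shows "(barreled scaleC \<longrightarrow>
            (\<exists>X :: ('a \<Rightarrow> complex) topology.
               functionally_Hausdorff X \<and>
               (\<forall>A. relatively_pseudocompact_in X A \<longrightarrow> relatively_compact_in X A) \<and>
               isomorphic_to_cfun scaleC star X)) \<and>
         ((\<exists>X :: 'x topology.
               functionally_Hausdorff X \<and>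
               (\<forall>A. relatively_pseudocompact_in X A \<longrightarrow> relatively_compact_in X A) \<and>
               isomorphic_to_cfun scaleC star X) \<longrightarrow>
          barreled scaleC)"
proof (intro conjI impI)
  interpret commutative_pro_cstar_algebra scaleC star
    using assms by (simp add: commutative_pro_cstar_algebra_def)
  show "\<exists>X :: ('a \<Rightarrow> complex) topology.
      functionally_Hausdorff X \<and>
      (\<forall>A. relatively_pseudocompact_in X A \<longrightarrow> relatively_compact_in X A) \<and>
      isomorphic_to_cfun scaleC star X" if "barreled scaleC"
    using that functionally_Hausdorff_spectral relatively_compact_spectral isomorphic_to_cfun_spectral
    by blast
next
  assume "\<exists>X :: 'x topology. functionally_Hausdorff X \<and>
      (\<forall>A. relatively_pseudocompact_in X A \<longrightarrow> relatively_compact_in X A) \<and>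
      isomorphic_to_cfun scaleC star X"
  then obtain X :: "'x topology" and \<phi>
    where X: "\<And>A. relatively_pseudocompact_in X A \<Longrightarrow> relatively_compact_in X A"
      and iso: "star_algebra_iso_cfun scaleC star X \<phi>"
    unfolding isomorphic_to_cfun_def by blast
  interpret cfun_algebra scaleC star X \<phi>
    using assms iso by (simp add: cfun_algebra_def cfun_algebra_axioms_def pro_cstar_algebra_def)
  show "barreled scaleC"
    using X by (rule barreled_if_pseudocompact_imp_compact)
qed

end
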